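(* Let $\mathfrak g$ be a non-compact semisimple Lie algebra with Cartan decomposition $\mathfrak g=\mathfrak k\oplus\mathfrak s$ and Cartan involution $\theta$, let $\mathfrak a\subset\mathfrak s$ be maximal abelian with a choice of positive Weyl chamber $\mathfrak a^+$, let $G=\mathrm{Aut}_0\,\mathfrak g$, let $K\subset G$ be the subgroup generated by $\exp\mathfrak k$, and let $H\in\mathrm{cl}(\mathfrak a^+)$. Then the adjoint orbit $\mathrm{Ad}(G)\cdot H$ deforms into the semi-direct product orbit $K_{\mathrm{ad}}\cdot H$, by $\psi_r$, where $\psi_r(Z)=Z+\frac{r-1}{r+1}\theta Z$ for $Z\in\mathfrak g$, $r>0$.
   Context: The word "deforms" is used informally and refers to the following family. For $r>0$ let $T_r:\mathfrak g\to\mathfrak g$ be the linear map equal to $r\cdot\mathrm{id}$ on $\mathfrak k$ and to $\mathrm{id}$ on $\mathfrak s$, and let $\mathfrak g_r$ be the vector space $\mathfrak g$ with the bracket $[X,Y]_r=T_r[T_r^{-1}X,T_r^{-1}Y]$ (so $\mathfrak g_1=\mathfrak g$). $\mathrm{Ad}_r(G)\cdot H$ denotes the adjoint orbit of $H$ under $\mathrm{Aut}_0\,\mathfrak g_r$, viewed in the vector space $\mathfrak g$. With $\mathfrak g_\alpha$ the root spaces of $\mathfrak a$ in $\mathfrak g$ and $\mathfrak n_H^+=\sum_{\alpha(H)>0}\mathfrak g_\alpha$, these orbits are $\mathrm{Ad}_r(G)\cdot H=\bigcup_{k\in K}\big(\mathrm{Ad}(k)H+\psi_r(\mathrm{Ad}(k)\mathfrak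 n_H^+)\big)$, with $r=1$ giving $\mathrm{Ad}(G)\cdot H$. As $r\to\infty$, $\psi_r\to\psi$, where $\psi(Z)=Z+\theta Z$, and the limiting set $\bigcup_{k\in K}\mathrm{Ad}(k)\big(H+\psi(\mathfrak n_H^+)\big)$ is identified with $K_{\mathrm{ad}}\cdot H$. Here $K_{\mathrm{ad}}=K\times_{\mathrm{Ad}}\mathfrak s$ is the semi-direct product of $K$ with $\mathfrak s$ (viewed as an abelian group) under the adjoint action, and $K_{\mathrm{ad}}\cdot H$ is the orbit of $H$ under its coadjoint representation, the dual of its Lie algebra $\mathfrak k\times\mathfrak s$ being identified with $\mathfrak k\oplus\mathfrak s=\mathfrak g$ through the inner product $B_\theta(X,Y)=-\langle X,\theta Y\rangle$ ($\langle\cdot,\cdot\rangle$ the Cartan-Killing form of $\mathfrak g$); explicitly $K_{\mathrm{ad}}\cdot H=\bigcup_{k\in K}\big(\mathrm{Ad}(k)H+[\mathrm{Ad}(k)H,\mathfrak s]\big)$. *)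

theory Defs
  imports "HOL-Analysis.Analysis" "HOL-Algebra.Generated_Groups"
begin

text \<open>
  A finite-dimensional real Lie algebra is a bracket on a Euclidean space. The Euclidean
  structure of the type serves only to provide the vector space topology; its inner product plays
  no role in the definitions, the trace below being independent of the chosen basis.
\<close>

section \<open>Real Lie algebras\<close>

definition lie_bracket :: "('a::euclidean_space \<Rightarrow> 'a \<Rightarrow> 'a) \<Rightarrow> bool" where
  "lie_bracket br \<longleftrightarrow> bilinear br \<and> (\<forall>X. br X X = 0) \<and>
     (\<forall>X Y Z. br X (br Y Z) + br Y (br Z X) + br Z (br X Y) = 0)"

definition ad :: "('a::euclidean_space \<Rightarrow> 'a \<Rightarrow> 'a) \<Rightarrow> 'a \<Rightarrow> 'a \<Rightarrow>\<^sub>L 'a" where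
  "ad br X = Blinfun (br X)"

definition lin_trace :: "('a::euclidean_space \<Rightarrow>\<^sub>L 'a) \<Rightarrow> real" where
  "lin_trace A = (\<Sum>b\<in>Basis. blinfun_apply A b \<bullet> b)"

definition killing :: "('a::euclidean_space \<Rightarrow> 'a \<Rightarrow> 'a) \<Rightarrow> 'a \<Rightarrow> 'a \<Rightarrow> real" where
  "killing br X Y = lin_trace (ad br X o\<^sub>L ad br Y)"

definition lie_ideal :: "('a::euclidean_space \<Rightarrow> 'a \<Rightarrow> 'a) \<Rightarrow> 'a set \<Rightarrow> bool" where
  "lie_ideal br I \<longleftrightarrow> subspace I \<and> (\<forall>X. \<forall>Y\<in>I. br X Y \<in> I)"

definition derived_algebra :: "('a::euclidean_space \<Rightarrow> 'a \<Rightarrow> 'a) \<Rightarrow> 'a set \<Rightarrow> 'a set" where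
  "derived_algebra br I = span {br X Y | X Y. X \<in> I \<and> Y \<in> I}"

definition solvable_subalgebra :: "('a::euclidean_space \<Rightarrow> 'a \<Rightarrow> 'a) \<Rightarrow> 'a set \<Rightarrow> bool" where
  "solvable_subalgebra br I \<longleftrightarrow> (\<exists>n. (derived_algebra br ^^ n) I = {0})"

definition semisimple_lie :: "('a::euclidean_space \<Rightarrow> 'a \<Rightarrow> 'a) \<Rightarrow> bool" where
  "semisimple_lie br \<longleftrightarrow> lie_bracket br \<and>
     (\<forall>I. lie_ideal br I \<and> solvable_subalgebra br I \<longrightarrow> I = {0})"

definition compact_type :: "('a::euclidean_space \<Rightarrow> 'a \<Rightarrow> 'a) \<Rightarrow> bool" where
  "compact_type br \<longleftrightarrow> (\<forall>X. X \<noteq> 0 \<longrightarrow> killing br X X < 0)"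

section \<open>Automorphisms and the identity component of the automorphism group\<close>

definition lie_aut :: "('a::euclidean_space \<Rightarrow> 'a \<Rightarrow> 'a) \<Rightarrow> ('a \<Rightarrow>\<^sub>L 'a) set" where
  "lie_aut br = {A. bij (blinfun_apply A) \<and>
     (\<forall>X Y. blinfun_apply A (br X Y) = br (blinfun_apply A X) (blinfun_apply A Y))}"

text \<open>The topology is that of the operator norm.\<close>

definition Aut0 :: "('a::euclidean_space \<Rightarrow> 'a \<Rightarrow> 'a) \<Rightarrow> ('a \<Rightarrow>\<^sub>L 'a) monoid" where
  "Aut0 br = \<lparr>carrier = connected_component_set (lie_aut br) id_blinfun,
              mult = (o\<^sub>L), one = id_blinfun\<rparr>"

text \<open>
  For semisimple \<open>br\<close> the Lie algebra of \<open>Aut0 br\<close> is the image of the injective map \<open>ad br\<close>, and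
  \<open>g \<circ> ad X \<circ> inv g = ad (g X)\<close>. Under the identification of \<open>X\<close> with \<open>ad X\<close>, the adjoint
  representation of \<open>Aut0 br\<close> is therefore its tautological action.
\<close>

definition adjoint_orbit :: "('a::euclidean_space \<Rightarrow> 'a \<Rightarrow> 'a) \<Rightarrow> 'a \<Rightarrow> 'a set" where
  "adjoint_orbit br H = (\<lambda>g. blinfun_apply g H) ` carrier (Aut0 br)"

section \<open>Cartan decomposition\<close>

definition B_form :: "('a::euclidean_space \<Rightarrow> 'a \<Rightarrow> 'a) \<Rightarrow> ('a \<Rightarrow>\<^sub>L 'a) \<Rightarrow> 'a \<Rightarrow> 'a \<Rightarrow> real" where
  "B_form br \<theta> X Y = - killing br X (blinfun_apply \<theta> Y)"

definition cartan_involution :: "('a::euclidean_space \<Rightarrow> 'a \<Rightarrow> 'a) \<Rightarrow> ('a \<Rightarrow>\<^sub>L 'a) \<Rightarrow> bool" where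
  "cartan_involution br \<theta> \<longleftrightarrow> \<theta> \<in> lie_aut br \<and> \<theta> o\<^sub>L \<theta> = id_blinfun \<and>
     (\<forall>X. X \<noteq> 0 \<longrightarrow> B_form br \<theta> X X > 0)"

definition cartan_k :: "('a::euclidean_space \<Rightarrow>\<^sub>L 'a) \<Rightarrow> 'a set" where
  "cartan_k \<theta> = {X. blinfun_apply \<theta> X = X}"

definition cartan_s :: "('a::euclidean_space \<Rightarrow>\<^sub>L 'a) \<Rightarrow> 'a set" where
  "cartan_s \<theta> = {X. blinfun_apply \<theta> X = - X}"

definition abelian_subspace :: "('a::euclidean_space \<Rightarrow> 'a \<Rightarrow> 'a) \<Rightarrow> 'a set \<Rightarrow> bool" where
  "abelian_subspace br V \<longleftrightarrow> subspace V \<and> (\<forall>X\<in>V. \<forall>Y\<in>V. br X Y = 0)"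

definition maximal_abelian_in :: "('a::euclidean_space \<Rightarrow> 'a \<Rightarrow> 'a) \<Rightarrow> 'a set \<Rightarrow> 'a set \<Rightarrow> bool" where
  "maximal_abelian_in br S V \<longleftrightarrow> V \<subseteq> S \<and> abelian_subspace br V \<and>
     (\<forall>W. W \<subseteq> S \<and> abelian_subspace br W \<and> V \<subseteq> W \<longrightarrow> W = V)"

section \<open>Restricted roots, Weyl chambers and \<open>n\<^sub>H\<^sup>+\<close>\<close>

definition root_space :: "('a::euclidean_space \<Rightarrow> 'a \<Rightarrow> 'a) \<Rightarrow> 'a set \<Rightarrow> ('a \<Rightarrow> real) \<Rightarrow> 'a set" where
  "root_space br a \<alpha> = {X. \<forall>A\<in>a. br A X = \<alpha> A *\<^sub>R X}"

text \<open>
  Functionals on \<open>a\<close> are given by functionals on the whole space. A root thus has several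
  representatives, but everything below depends on their values on \<open>a\<close> only.
\<close>

definition roots :: "('a::euclidean_space \<Rightarrow> 'a \<Rightarrow> 'a) \<Rightarrow> 'a set \<Rightarrow> ('a \<Rightarrow> real) set" where
  "roots br a = {\<alpha>. linear \<alpha> \<and> (\<exists>A\<in>a. \<alpha> A \<noteq> 0) \<and> root_space br a \<alpha> \<noteq> {0}}"

definition weyl_chambers :: "('a::euclidean_space \<Rightarrow> 'a \<Rightarrow> 'a) \<Rightarrow> 'a set \<Rightarrow> 'a set set" where
  "weyl_chambers br a = components {A \<in> a. \<forall>\<alpha>\<in>roots br a. \<alpha> A \<noteq> 0}"

definition n_plus :: "('a::euclidean_space \<Rightarrow> 'a \<Rightarrow> 'a) \<Rightarrow> 'a set \<Rightarrow> 'a \<Rightarrow> 'a set" where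
  "n_plus br a H = span (\<Union>\<alpha>\<in>{\<alpha>\<in>roots br a. \<alpha> H > 0}. root_space br a \<alpha>)"

section \<open>The group \<open>K\<close>\<close>

definition exp_blinfun :: "('a::euclidean_space \<Rightarrow>\<^sub>L 'a) \<Rightarrow> 'a \<Rightarrow>\<^sub>L 'a" where
  "exp_blinfun A = (\<Sum>n. (1 / fact n) *\<^sub>R (((o\<^sub>L) A ^^ n) id_blinfun))"

definition K_group :: "('a::euclidean_space \<Rightarrow> 'a \<Rightarrow> 'a) \<Rightarrow> ('a \<Rightarrow>\<^sub>L 'a) \<Rightarrow> ('a \<Rightarrow>\<^sub>L 'a) set" where
  "K_group br \<theta> = generate (Aut0 br) ((\<lambda>X. exp_blinfun (ad br X)) ` cartan_k \<theta>)"

section \<open>The deformation\<close>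

definition deform_T :: "('a::euclidean_space \<Rightarrow>\<^sub>L 'a) \<Rightarrow> real \<Rightarrow> 'a \<Rightarrow>\<^sub>L 'a" where
  "deform_T \<theta> r = (r / 2) *\<^sub>R (id_blinfun + \<theta>) + (1 / 2) *\<^sub>R (id_blinfun - \<theta>)"

lemma deform_T_k: "X \<in> cartan_k \<theta> \<Longrightarrow> blinfun_apply (deform_T \<theta> r) X = r *\<^sub>R X"
  by (simp add: deform_T_def cartan_k_def plus_blinfun.rep_eq minus_blinfun.rep_eq
      scaleR_blinfun.rep_eq flip: scaleR_2)

lemma deform_T_s: "X \<in> cartan_s \<theta> \<Longrightarrow> blinfun_apply (deform_T \<theta> r) X = X"
  by (simp add: deform_T_def cartan_s_def plus_blinfun.rep_eq minus_blinfun.rep_eq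
      scaleR_blinfun.rep_eq flip: scaleR_2)

definition deform_bracket ::
  "('a::euclidean_space \<Rightarrow> 'a \<Rightarrow> 'a) \<Rightarrow> ('a \<Rightarrow>\<^sub>L 'a) \<Rightarrow> real \<Rightarrow> 'a \<Rightarrow> 'a \<Rightarrow> 'a" where
  "deform_bracket br \<theta> r X Y =
     (let T = blinfun_apply (deform_T \<theta> r) in T (br (inv_into UNIV T X) (inv_into UNIV T Y)))"

definition psi :: "('a::euclidean_space \<Rightarrow>\<^sub>L 'a) \<Rightarrow> real \<Rightarrow> 'a \<Rightarrow>\<^sub>L 'a" where
  "psi \<theta> r = id_blinfun + ((r - 1) / (r + 1)) *\<^sub>R \<theta>"

definition psi_lim :: "('a::euclidean_space \<Rightarrow>\<^sub>L 'a) \<Rightarrow> 'a \<Rightarrow>\<^sub>L 'a" where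
  "psi_lim \<theta> = id_blinfun + \<theta>"

section \<open>The semi-direct product and its coadjoint orbits\<close>

definition K_ad ::
  "('a::euclidean_space \<Rightarrow> 'a \<Rightarrow> 'a) \<Rightarrow> ('a \<Rightarrow>\<^sub>L 'a) \<Rightarrow> (('a \<Rightarrow>\<^sub>L 'a) \<times> 'a) monoid" where
  "K_ad br \<theta> = \<lparr>carrier = K_group br \<theta> \<times> cartan_s \<theta>,
     mult = (\<lambda>(k, v) (l, w). (k o\<^sub>L l, v + blinfun_apply k w)),
     one = (id_blinfun, 0)\<rparr>"

text \<open>
  The Lie algebra of \<open>K_ad br \<theta>\<close> is \<open>cartan_k \<theta> \<times> cartan_s \<theta>\<close>: the pair \<open>(X, Y)\<close> corresponds to the
  tangent vector \<open>(ad br X, Y)\<close> at the identity, which is the velocity at \<open>t = 0\<close> of the curve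
  \<open>(exp (t ad X), t Y)\<close>. The adjoint representation is the derivative of conjugation.
\<close>

definition K_ad_Ad ::
  "('a::euclidean_space \<Rightarrow> 'a \<Rightarrow> 'a) \<Rightarrow> ('a \<Rightarrow>\<^sub>L 'a) \<Rightarrow> ('a \<Rightarrow>\<^sub>L 'a) \<times> 'a \<Rightarrow> 'a \<times> 'a \<Rightarrow> 'a \<times> 'a" where
  "K_ad_Ad br \<theta> p \<xi> = (THE \<eta>. \<eta> \<in> cartan_k \<theta> \<times> cartan_s \<theta> \<and>
     ((\<lambda>t. p \<otimes>\<^bsub>K_ad br \<theta>\<^esub> (exp_blinfun (t *\<^sub>R ad br (fst \<xi>)), t *\<^sub>R snd \<xi>)
             \<otimes>\<^bsub>K_ad br \<theta>\<^esub> inv\<^bsub>K_ad br \<theta>\<^esub> p)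
        has_vector_derivative (ad br (fst \<eta>), snd \<eta>)) (at 0))"

text \<open>
  \<open>Z\<close> stands for the functional \<open>(X, Y) \<mapsto> B_form br \<theta> Z (X + Y)\<close> on the Lie algebra of
  \<open>K_ad br \<theta>\<close>, and \<open>p\<close> acts on functionals by composition with the adjoint action of the inverse
  of \<open>p\<close>.
\<close>

definition K_ad_coadjoint_orbit ::
  "('a::euclidean_space \<Rightarrow> 'a \<Rightarrow> 'a) \<Rightarrow> ('a \<Rightarrow>\<^sub>L 'a) \<Rightarrow> 'a \<Rightarrow> 'a set" where
  "K_ad_coadjoint_orbit br \<theta> H = {Z. \<exists>p\<in>carrier (K_ad br \<theta>).
     \<forall>X\<in>cartan_k \<theta>. \<forall>Y\<in>cartan_s \<theta>.
       B_form br \<theta> Z (X + Y) =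
       (case K_ad_Ad br \<theta> (inv\<^bsub>K_ad br \<theta>\<^esub> p) (X, Y) of (X', Y') \<Rightarrow> B_form br \<theta> H (X' + Y'))}"

end

theory Submission
  imports Defs
begin

text \<open>
  The heart of the matter is that the orbit of \<open>H\<close> under \<open>Aut0 br\<close> is the union of the sets
  \<open>k (H + n)\<close>, \<open>k \<in> K\<close>, where \<open>n\<close> is the sum of the eigenspaces of \<open>ad H\<close> for positive eigenvalues.
  That \<open>H + n\<close> lies in the orbit follows by eliminating \<open>z \<in> n\<close> degree by degree with elements
  \<open>exp (ad X)\<close>. Conversely, let \<open>P\<close> be the set of operators that map \<open>H + n\<close> into itself. Then \<open>K P\<close> is
  closed since \<open>K\<close> is compact, and its intersection with the automorphism group is relatively open,
  since an automorphism close to the identity is a product \<open>exp (ad Y) exp (ad Z)\<close> with \<open>Y \<in> cartan_k \<theta>\<close>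
  and \<open>Z\<close> in the sum of the eigenspaces of \<open>ad H\<close> for non-negative eigenvalues. By connectedness it
  contains \<open>Aut0 br\<close>.

  The orbit of the deformed bracket is the image of this orbit under \<open>deform_T \<theta> r\<close>, which is a
  multiple of \<open>psi \<theta> r\<close>. Computing the coadjoint action gives the union of the sets \<open>k (H + [s, H])\<close>,
  with \<open>s = cartan_s \<theta>\<close>, and \<open>[s, H]\<close> is the image of \<open>n\<close> under \<open>id + \<theta>\<close>.
\<close>

section \<open>The exponential of an endomorphism\<close>

text \<open>\<open>K_group\<close> is merely generated by exponentials, so its closedness is not
  evident; nor is it evident that products of exponentials fill a neighbourhood of the identity
  among the automorphisms. Both come from one local statement,
  \<open>lie_aut_local_factorization\<close>, valid for any two linear maps with sum the identity.
  For \<open>cartan_k \<theta>\<close> and \<open>cartan_s \<theta>\<close> it shows that K is open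
  in the group of automorphisms commuting with \<theta>, which is compact because it preserves
  \<open>B_form\<close>; for \<open>cartan_k \<theta>\<close> and the non-negative eigenspaces it
  gives the openness in the connectedness argument.

  Automorphisms are known only as solutions of equations, not as a manifold. Their displacement from
  the identity is therefore controlled through its projection to the inner derivations; that the
  rest vanishes too follows because all derivations are inner, a consequence of the nondegenerate
  Killing form.

  Eigenspaces of \<open>ad H\<close> replace root spaces, since \<open>H\<close> may lie on a wall
  and only signs of eigenvalues matter. Root spaces return at the end, by joint diagonalization over
  \<open>a\<close>.\<close>

lemma norm_exp_minus_one_minus_le:
  fixes a :: "'a::{real_normed_algebra_1,banach}"
  assumes "norm a \<le> 1"
  shows "norm (exp a - 1 - a) \<le> (norm a)\<^sup>2"
proof -
  have ns: "summable (\<lambda>n. norm a ^ n /\<^sub>R fact n)" by (rule summable_exp_generic)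
  have s2: "summable (\<lambda>n. norm a ^ (n+2) /\<^sub>R fact (n+2))"
    using ns by (simp only: summable_iff_shift[of "\<lambda>n. norm a ^ n /\<^sub>R fact n" 2])
  have le: "norm (a ^ (n+2) /\<^sub>R fact (n+2)) \<le> norm a ^ (n+2) /\<^sub>R fact (n+2)" for n
    unfolding norm_scaleR real_scaleR_def by (intro mult_mono norm_power_ineq) auto
  have "exp a - 1 - a = (\<Sum>n. a ^ (n+2) /\<^sub>R fact (n+2))"
    using exp_first_two_terms[of a] by (simp only: add.assoc add_diff_cancel_left')
  then have "norm (exp a - 1 - a) \<le> (\<Sum>n. norm a ^ (n+2) /\<^sub>R fact (n+2))"
    using norm_suminf_le[OF le s2] by (simp only:)
  also have "\<dots> = exp (norm a) - 1 - norm a"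
    using exp_first_two_terms[of "norm a"] by (simp only:)
  also have "\<dots> \<le> (norm a)\<^sup>2"
    using exp_bound[of "norm a"] assms by simp
  finally show ?thesis .
qed

lemma norm_exp_le_3:
  fixes a :: "'a::{real_normed_algebra_1,banach}"
  assumes "norm a \<le> 1"
  shows "norm (exp a) \<le> 3"
proof -
  have "norm (exp a) \<le> exp (norm a)" by (rule norm_exp)
  also have "\<dots> \<le> exp 1" using assms by simp
  also have "\<dots> \<le> 3" by (rule exp_le)
  finally show ?thesis .
qed

text \<open>The series converges uniformly on bounded sets only, so continuity is obtained on balls
  and then at each point.\<close>

lemma continuous_on_exp_algebra:
  "continuous_on (S :: 'a::{real_normed_algebra_1,banach} set) exp"
proof -
  have "continuous_on (ball 0 R) (exp :: 'a \<Rightarrow> 'a)" for R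
  proof (rule uniform_limit_theorem)
    show "uniform_limit (ball 0 R) (\<lambda>n x. \<Sum>i<n. x ^ i /\<^sub>R fact i) (exp :: 'a \<Rightarrow> 'a) sequentially"
      unfolding exp_def
    proof (rule Weierstrass_m_test)
      show "summable (\<lambda>n. \<bar>R\<bar> ^ n /\<^sub>R fact n)" by (rule summable_exp_generic)
      show "norm (x ^ n /\<^sub>R fact n) \<le> \<bar>R\<bar> ^ n /\<^sub>R fact n" if "x \<in> ball 0 R" for x :: 'a and n
      proof -
        have "norm (x ^ n) \<le> norm x ^ n" by (rule norm_power_ineq)
        also have "\<dots> \<le> \<bar>R\<bar> ^ n" using that by (intro power_mono) auto
        finally show ?thesis
          unfolding norm_scaleR real_scaleR_def by (intro mult_mono) auto
      qed
    qed
    show "\<forall>\<^sub>F n in sequentially. continuous_on (ball 0 R) (\<lambda>x::'a. \<Sum>i<n. x ^ i /\<^sub>R fact i)"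
      by (intro always_eventually allI continuous_intros)
  qed simp
  then have "isCont exp x" if "x \<in> ball 0 (norm x + 1)" for x :: 'a
    using continuous_on_eq_continuous_at[OF open_ball] that by blast
  then have "isCont exp x" for x :: 'a by simp
  then show ?thesis by (simp add: continuous_at_imp_continuous_on)
qed

text \<open>The relation passes to powers and then through the series. Phrased as an intertwining
  instead of a conjugation, it avoids inverses of \<open>b\<close>.\<close>

lemma exp_intertwines:
  fixes a b c :: "'a::{real_normed_algebra_1,banach}"
  assumes "b * a = c * b"
  shows "b * exp a = exp c * b"
proof -
  have pow: "b * a ^ n = c ^ n * b" for n
  proof (induction n)
    case (Suc n)
    have "b * a ^ Suc n = (b * a) * a ^ n" by (simp add: mult.assoc)
    also have "\<dots> = c * (b * a ^ n)" by (simp add: assms mult.assoc)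
    finally show ?case by (simp add: Suc mult.assoc)
  qed simp
  have "(\<lambda>n. b * (a ^ n /\<^sub>R fact n)) sums (b * exp a)"
    by (rule bounded_linear.sums[OF bounded_linear_mult_right exp_converges])
  moreover have "(\<lambda>n. (c ^ n /\<^sub>R fact n) * b) sums (exp c * b)"
    by (rule bounded_linear.sums[OF bounded_linear_mult_left exp_converges])
  ultimately show ?thesis
    using sums_unique2 by (fastforce simp: pow)
qed

text \<open>Write \<open>exp (- a) = 1 + (r - a)\<close> and \<open>exp (- b) = 1 + (s - b)\<close>
  with \<open>r\<close>, \<open>s\<close> of second order. The error is
  \<open>r + s + (r - a) * (s - b)\<close>, at most \<open>(1 + 1 + 4) * e\<^sup>2\<close>, plus
  \<open>g - 1\<close> between two exponentials of norm at most 3.\<close>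

lemma norm_exp_product_estimate:
  fixes a b g :: "'a::{real_normed_algebra_1,banach}"
  assumes a: "norm a \<le> e" and b: "norm b \<le> e" and e: "e \<le> 1"
  shows "norm (exp (-a) * g * exp (-b) - 1 + a + b) \<le> 6 * e\<^sup>2 + 9 * norm (g - 1)"
proof -
  have e0: "0 \<le> e" using a norm_ge_zero order_trans by blast
  define r where "r = exp (-a) - 1 + a"
  define s where "s = exp (-b) - 1 + b"
  have r: "norm r \<le> e\<^sup>2"
  proof -
    have "norm r \<le> (norm a)\<^sup>2"
      using norm_exp_minus_one_minus_le[of "-a"] a e by (simp add: r_def)
    also have "\<dots> \<le> e\<^sup>2" using a by (simp add: power_mono)
    finally show ?thesis .
  qed
  have s: "norm s \<le> e\<^sup>2"
  proof -
    have "norm s \<le> (norm b)\<^sup>2"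
      using norm_exp_minus_one_minus_le[of "-b"] b e by (simp add: s_def)
    also have "\<dots> \<le> e\<^sup>2" using b by (simp add: power_mono)
    finally show ?thesis .
  qed
  have e2: "e\<^sup>2 \<le> e" using e e0 by (simp add: power2_eq_square mult_left_le)
  have ar: "norm (r - a) \<le> 2 * e" using norm_triangle_ineq4[of r a] r a e2 by linarith
  have bs: "norm (s - b) \<le> 2 * e" using norm_triangle_ineq4[of s b] s b e2 by linarith
  have prod: "norm ((r - a) * (s - b)) \<le> 4 * e\<^sup>2"
  proof -
    have "norm ((r - a) * (s - b)) \<le> norm (r - a) * norm (s - b)" by (rule norm_mult_ineq)
    also have "\<dots> \<le> (2*e) * (2*e)" using ar bs e0 by (intro mult_mono) auto
    finally show ?thesis by (simp add: power2_eq_square)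
  qed
  have g: "norm (exp (-a) * (g - 1) * exp (-b)) \<le> 9 * norm (g - 1)"
  proof -
    have "norm (exp (-a) * (g - 1) * exp (-b)) \<le> norm (exp (-a)) * norm (g - 1) * norm (exp (-b))"
      by (meson norm_mult_ineq order_trans mult_right_mono norm_ge_zero)
    also have "\<dots> \<le> 3 * norm (g - 1) * 3"
      using norm_exp_le_3[of "-a"] norm_exp_le_3[of "-b"] a b e
      by (intro mult_mono) auto
    finally show ?thesis by simp
  qed
  have "exp (-a) * g * exp (-b) - 1 + a + b
      = exp (-a) * (g - 1) * exp (-b) + (exp (-a) * exp (-b) - 1 + a + b)"
    by (simp add: algebra_simps)
  also have "exp (-a) * exp (-b) - 1 + a + b = r + s + (r - a) * (s - b)"
    by (simp add: r_def s_def algebra_simps)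
  finally have "norm (exp (-a) * g * exp (-b) - 1 + a + b)
      = norm (exp (-a) * (g - 1) * exp (-b) + (r + s + (r - a) * (s - b)))" by (rule arg_cong)
  then show ?thesis
    using norm_triangle_ineq[of "exp (-a) * (g - 1) * exp (-b)" "r + s + (r - a) * (s - b)"]
      norm_triangle_ineq[of "r + s" "(r - a) * (s - b)"] norm_triangle_ineq[of r s] r s prod g
    by linarith
qed

text \<open>A copy of the type of endomorphisms, to make it an instance of the type class of Banach algebras,
  for which the library provides \<open>exp\<close>.\<close>

typedef (overloaded) 'a endo = "UNIV :: ('a::euclidean_space \<Rightarrow>\<^sub>L 'a) set"
  morphisms blin endo ..

setup_lifting type_definition_endo

instantiation endo :: (euclidean_space) real_normed_vector
begin
lift_definition zero_endo :: "'a endo" is 0 .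
lift_definition plus_endo :: "'a endo \<Rightarrow> 'a endo \<Rightarrow> 'a endo" is "(+)" .
lift_definition minus_endo :: "'a endo \<Rightarrow> 'a endo \<Rightarrow> 'a endo" is "(-)" .
lift_definition uminus_endo :: "'a endo \<Rightarrow> 'a endo" is uminus .
lift_definition scaleR_endo :: "real \<Rightarrow> 'a endo \<Rightarrow> 'a endo" is scaleR .
lift_definition norm_endo :: "'a endo \<Rightarrow> real" is norm .
definition dist_endo :: "'a endo \<Rightarrow> 'a endo \<Rightarrow> real" where "dist_endo x y = norm (x - y)"
definition sgn_endo :: "'a endo \<Rightarrow> 'a endo" where "sgn_endo x = scaleR (inverse (norm x)) x"
definition uniformity_endo :: "('a endo \<times> 'a endo) filter" where
  "uniformity_endo = (INF e\<in>{0 <..}. principal {(x, y). dist x y < e})"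
definition open_endo :: "'a endo set \<Rightarrow> bool" where
  "open_endo S = (\<forall>x\<in>S. \<forall>\<^sub>F (x', y) in uniformity. x' = x \<longrightarrow> y \<in> S)"
instance
proof
  fix x y :: "'a endo" and c :: real
  show "norm (x + y) \<le> norm x + norm y" by transfer (rule norm_triangle_ineq)
  show "(norm x = 0) = (x = 0)" by transfer simp
  show "norm (c *\<^sub>R x) = \<bar>c\<bar> * norm x" by transfer simp
qed (auto simp: dist_endo_def sgn_endo_def uniformity_endo_def open_endo_def,
    (transfer, simp add: algebra_simps)+)
end

lemma bounded_linear_blin: "bounded_linear blin"
  by (rule bounded_linear_intro[where K = 1]; transfer; simp)

lemma bounded_linear_endo: "bounded_linear endo"
  by (rule bounded_linear_intro[where K = 1])
     (simp_all add: plus_endo_def scaleR_endo_def norm_endo_def endo_inverse)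

instantiation endo :: (euclidean_space) "{real_normed_algebra_1,banach}"
begin
lift_definition one_endo :: "'a endo" is id_blinfun .
lift_definition times_endo :: "'a endo \<Rightarrow> 'a endo \<Rightarrow> 'a endo" is "(o\<^sub>L)" .
instance
proof
  fix x y z :: "'a endo" and c :: real
  show "norm (x * y) \<le> norm x * norm y" by transfer (rule norm_blinfun_compose)
  show "norm (1 :: 'a endo) = 1" by transfer simp
  show "0 \<noteq> (1 :: 'a endo)"
    by transfer (metis norm_blinfun_id norm_zero zero_neq_one)
  show "x * y * z = x * (y * z)" by transfer (auto intro: blinfun_eqI)
  show "(x + y) * z = x * z + y * z"
    by transfer (auto intro: blinfun_eqI simp: blinfun.add_left)
  show "x * (y + z) = x * y + x * z"
    by transfer (auto intro: blinfun_eqI simp: blinfun.add_left blinfun.add_right)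
  show "c *\<^sub>R x * y = c *\<^sub>R (x * y)" "x * c *\<^sub>R y = c *\<^sub>R (x * y)"
    by (transfer, auto intro!: blinfun_eqI simp: blinfun.scaleR_left blinfun.scaleR_right)+
  show "1 * x = x" "x * 1 = x"
    by (transfer, auto intro!: blinfun_eqI)+
next
  fix X :: "nat \<Rightarrow> 'a endo"
  assume "Cauchy X"
  then have "Cauchy (\<lambda>n. blin (X n))" by (rule bounded_linear.Cauchy[OF bounded_linear_blin])
  then obtain l where "(\<lambda>n. blin (X n)) \<longlonglongrightarrow> l" using Cauchy_convergent_iff convergent_def by blast
  then have "(\<lambda>n. endo (blin (X n))) \<longlonglongrightarrow> endo l"
    by (rule bounded_linear.tendsto[OF bounded_linear_endo])
  then show "convergent X" by (auto simp: blin_inverse convergent_def)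
qed
end

section \<open>Exponentials of operators, transferred from the Banach algebra\<close>

lemma endo_simps:
  "endo (A + B) = endo A + endo B" "endo (A - B) = endo A - endo B" "endo (- A) = - endo A"
  "endo (c *\<^sub>R A) = c *\<^sub>R endo A" "endo (A o\<^sub>L B) = endo A * endo B" "endo id_blinfun = 1"
  "endo 0 = 0" "norm (endo A) = norm A"
  by (simp_all add: plus_endo_def minus_endo_def uminus_endo_def scaleR_endo_def times_endo_def
      one_endo_def zero_endo_def norm_endo_def endo_inverse)

lemma endo_eq_iff [simp]: "endo A = endo B \<longleftrightarrow> A = B"
  by (simp add: endo_inject)

text \<open>Both sides are the same power series seen in two types; through this identity the laws
  of \<open>exp\<close> carry over to \<open>exp_blinfun\<close>.\<close>

lemma endo_exp_blinfun: "endo (exp_blinfun A) = exp (endo A)"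
proof -
  have pow: "endo A ^ n = endo (((o\<^sub>L) A ^^ n) id_blinfun)" for n
    by (induction n) (simp_all add: endo_simps)
  have "(\<lambda>n. blin (endo A ^ n /\<^sub>R fact n)) sums blin (exp (endo A))"
    by (rule bounded_linear.sums[OF bounded_linear_blin exp_converges])
  then have "(\<lambda>n. (1 / fact n) *\<^sub>R (((o\<^sub>L) A ^^ n) id_blinfun)) sums blin (exp (endo A))"
    by (simp add: pow endo_inverse inverse_eq_divide flip: endo_simps)
  then show ?thesis
    by (simp add: exp_blinfun_def sums_iff blin_inverse)
qed

lemma exp_blinfun_0: "exp_blinfun 0 = id_blinfun"
  by (simp add: endo_simps endo_exp_blinfun flip: endo_eq_iff)

lemma exp_blinfun_minus: "exp_blinfun A o\<^sub>L exp_blinfun (- A) = id_blinfun"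
  "exp_blinfun (- A) o\<^sub>L exp_blinfun A = id_blinfun"
  using exp_minus_inverse[of "endo A"] exp_minus_inverse[of "- endo A"]
  by (simp_all add: endo_simps endo_exp_blinfun flip: endo_eq_iff)

lemma exp_blinfun_double: "exp_blinfun (2 *\<^sub>R A) = exp_blinfun A o\<^sub>L exp_blinfun A"
  using exp_add_commuting[of "endo A" "endo A"]
  by (simp add: endo_simps endo_exp_blinfun scaleR_2 flip: endo_eq_iff)

lemma exp_blinfun_intertwines:
  fixes A B C :: "'a::euclidean_space \<Rightarrow>\<^sub>L 'a"
  shows "B o\<^sub>L A = C o\<^sub>L B \<Longrightarrow> B o\<^sub>L exp_blinfun A = exp_blinfun C o\<^sub>L B"
  using exp_intertwines[of "endo B" "endo A" "endo C"]
  by (simp add: endo_simps endo_exp_blinfun flip: endo_eq_iff)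

lemma continuous_on_exp_blinfun: "continuous_on S exp_blinfun"
proof -
  have "continuous_on S (\<lambda>A. blin (exp (endo A)))"
    by (intro bounded_linear.continuous_on[OF bounded_linear_blin]
        continuous_on_compose2[OF continuous_on_exp_algebra[of UNIV]]
        bounded_linear.continuous_on[OF bounded_linear_endo] continuous_on_id) auto
  then show ?thesis by (simp add: endo_inverse flip: endo_exp_blinfun)
qed

lemma exp_blinfun_has_vector_derivative:
  "((\<lambda>t. exp_blinfun (t *\<^sub>R A)) has_vector_derivative exp_blinfun (t *\<^sub>R A) o\<^sub>L A) (at t)"
  "((\<lambda>t. exp_blinfun (t *\<^sub>R A)) has_vector_derivative A o\<^sub>L exp_blinfun (t *\<^sub>R A)) (at t)"
proof -
  have "((\<lambda>t. blin (exp (t *\<^sub>R endo A))) has_vector_derivative blin (exp (t *\<^sub>R endo A) * endo A)) (at t)"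
    by (intro bounded_linear.has_vector_derivative[OF bounded_linear_blin]
        exp_scaleR_has_vector_derivative_right)
  then show "((\<lambda>t. exp_blinfun (t *\<^sub>R A)) has_vector_derivative exp_blinfun (t *\<^sub>R A) o\<^sub>L A) (at t)"
    by (simp add: endo_inverse flip: endo_exp_blinfun endo_simps)
  have "((\<lambda>t. blin (exp (t *\<^sub>R endo A))) has_vector_derivative blin (endo A * exp (t *\<^sub>R endo A))) (at t)"
    by (intro bounded_linear.has_vector_derivative[OF bounded_linear_blin]
        exp_scaleR_has_vector_derivative_left)
  then show "((\<lambda>t. exp_blinfun (t *\<^sub>R A)) has_vector_derivative A o\<^sub>L exp_blinfun (t *\<^sub>R A)) (at t)"
    by (simp add: endo_inverse flip: endo_exp_blinfun endo_simps)
qed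

lemma norm_exp_blinfun_minus_id_minus_le:
  "norm A \<le> 1 \<Longrightarrow> norm (exp_blinfun A - id_blinfun - A) \<le> (norm A)\<^sup>2"
  using norm_exp_minus_one_minus_le[of "endo A"]
  by (simp add: endo_exp_blinfun flip: endo_simps(8)) (simp add: endo_simps endo_exp_blinfun)

lemma norm_exp_blinfun_product_estimate:
  assumes "norm A \<le> e" "norm B \<le> e" "e \<le> 1"
  shows "norm ((exp_blinfun (- A) o\<^sub>L g o\<^sub>L exp_blinfun (- B)) - id_blinfun + A + B)
    \<le> 6 * e\<^sup>2 + 9 * norm (g - id_blinfun)"
proof -
  have "norm (endo ((exp_blinfun (- A) o\<^sub>L g o\<^sub>L exp_blinfun (- B)) - id_blinfun + A + B))
    \<le> 6 * e\<^sup>2 + 9 * norm (endo (g - id_blinfun))"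
    using norm_exp_product_estimate[of "endo A" e "endo B" "endo g"] assms
    by (simp only: endo_simps endo_exp_blinfun simp_thms)
  then show ?thesis by (simp only: endo_simps(8))
qed

lemma exp_blinfun_sums:
  "(\<lambda>n. (1 / fact n) *\<^sub>R (blinfun_apply A ^^ n) x) sums blinfun_apply (exp_blinfun A) x"
proof -
  have pow: "blinfun_apply (blin (endo A ^ n)) x = (blinfun_apply A ^^ n) x" for n
    by (induction n) (simp_all add: one_endo.rep_eq times_endo.rep_eq endo_inverse)
  have "(\<lambda>n. blinfun_apply (blin (endo A ^ n /\<^sub>R fact n)) x) sums blinfun_apply (blin (exp (endo A))) x"
    by (intro bounded_linear.sums[OF blinfun.bounded_linear_left]
        bounded_linear.sums[OF bounded_linear_blin exp_converges])
  then show ?thesis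
    by (simp add: pow scaleR_endo.rep_eq scaleR_blinfun.rep_eq endo_inverse inverse_eq_divide flip: endo_exp_blinfun)
qed

lemma sums_in_subspace:
  fixes V :: "'a::euclidean_space set"
  assumes "subspace V" "f sums l" "\<And>n. f n \<in> V"
  shows "l \<in> V"
  using closed_sequentially[OF closed_subspace[OF assms(1)]] assms
  by (metis (no_types, lifting) sums_def subspace_sum)

text \<open>All terms of the series after the zeroth lie in \<open>V\<close>, which is closed. The
  vector \<open>x\<close> itself may lie outside \<open>V\<close>, as happens in the
  applications.\<close>

lemma exp_blinfun_apply_diff_in_subspace:
  assumes V: "subspace V" and x: "blinfun_apply A x \<in> V"
    and inv: "\<And>v. v \<in> V \<Longrightarrow> blinfun_apply A v \<in> V"
  shows "blinfun_apply (exp_blinfun A) x - x \<in> V"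
proof -
  have "(blinfun_apply A ^^ Suc n) x \<in> V" for n
    by (induction n) (use x inv in auto)
  moreover have "(\<lambda>n. (1 / fact (Suc n)) *\<^sub>R (blinfun_apply A ^^ Suc n) x) sums
      (blinfun_apply (exp_blinfun A) x - x)"
    using exp_blinfun_sums[of A x] by (subst sums_Suc_iff) simp
  ultimately show ?thesis
    using sums_in_subspace[OF V] subspace_scale[OF V] by blast
qed

text \<open>Keeps the first-order term apart: for \<open>x = H\<close> below, \<open>A x\<close> is
  only known to lie in a larger subspace than all later terms.\<close>

lemma exp_blinfun_apply_diff_in_subspace':
  assumes V: "subspace V" and x: "blinfun_apply A (blinfun_apply A x) \<in> V"
    and inv: "\<And>v. v \<in> V \<Longrightarrow> blinfun_apply A v \<in> V"
  shows "blinfun_apply (exp_blinfun A) x - x - blinfun_apply A x \<in> V"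
proof -
  have "(blinfun_apply A ^^ Suc (Suc n)) x \<in> V" for n
    by (induction n) (use x inv in auto)
  moreover have "(\<lambda>n. (1 / fact (Suc (Suc n))) *\<^sub>R (blinfun_apply A ^^ Suc (Suc n)) x) sums
      (blinfun_apply (exp_blinfun A) x - x - blinfun_apply A x)"
    using exp_blinfun_sums[of A x]
    by (subst sums_Suc_iff[where f = "\<lambda>n. (1 / fact (Suc n)) *\<^sub>R (blinfun_apply A ^^ Suc n) x"],
        subst sums_Suc_iff) simp
  ultimately show ?thesis
    using sums_in_subspace[OF V] subspace_scale[OF V] by blast
qed

section \<open>Lie algebras, automorphisms and derivations\<close>

lemma bij_blinfun_inverse:
  fixes g :: "'a::euclidean_space \<Rightarrow>\<^sub>L 'a"
  assumes "bij (blinfun_apply g)"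
  obtains h where "g o\<^sub>L h = id_blinfun" "h o\<^sub>L g = id_blinfun"
proof -
  have "bounded_linear (inv_into UNIV (blinfun_apply g))"
    using assms by (intro inj_linear_imp_inv_bounded_linear blinfun.bounded_linear_right) (simp add: bij_is_inj)
  then have "blinfun_apply (Blinfun (inv_into UNIV (blinfun_apply g))) = inv_into UNIV (blinfun_apply g)"
    by (rule bounded_linear_Blinfun_apply)
  then have "g o\<^sub>L Blinfun (inv_into UNIV (blinfun_apply g)) = id_blinfun"
    "Blinfun (inv_into UNIV (blinfun_apply g)) o\<^sub>L g = id_blinfun"
    using assms by (auto intro!: blinfun_eqI simp: bij_is_surj surj_f_inv_f bij_is_inj)
  then show ?thesis by (rule that)
qed

lemma id_blinfun_compose: "id_blinfun o\<^sub>L A = A"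
  by (auto intro: blinfun_eqI)

lemma blinfun_compose_idD:
  "g o\<^sub>L h = id_blinfun \<Longrightarrow> blinfun_apply g (blinfun_apply h x) = x"
  by (metis blinfun_apply_blinfun_compose blinfun_apply_id_blinfun id_apply)

lemma blinfun_compose_commuteD:
  "a o\<^sub>L b = b o\<^sub>L a \<Longrightarrow> blinfun_apply a (blinfun_apply b x) = blinfun_apply b (blinfun_apply a x)"
  by (metis blinfun_apply_blinfun_compose)

lemma bij_blinfunI:
  assumes "g o\<^sub>L h = id_blinfun" "h o\<^sub>L g = id_blinfun"
  shows "bij (blinfun_apply g)"
  using assms[THEN blinfun_compose_idD] by (intro o_bij[of "blinfun_apply h"]) (simp_all add: fun_eq_iff)

lemma lin_trace_commute:
  fixes A B :: "'a::euclidean_space \<Rightarrow>\<^sub>L 'a"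
  shows "lin_trace (A o\<^sub>L B) = lin_trace (B o\<^sub>L A)"
proof -
  have *: "lin_trace (A o\<^sub>L B) = (\<Sum>b\<in>Basis. \<Sum>c\<in>Basis. (blinfun_apply B b \<bullet> c) * (blinfun_apply A c \<bullet> b))"
    for A B :: "'a \<Rightarrow>\<^sub>L 'a"
  proof -
    have "blinfun_apply A (blinfun_apply B b) \<bullet> b
        = (\<Sum>c\<in>Basis. (blinfun_apply B b \<bullet> c) * (blinfun_apply A c \<bullet> b))" for b
    proof -
      have "blinfun_apply A (blinfun_apply B b)
          = blinfun_apply A (\<Sum>c\<in>Basis. (blinfun_apply B b \<bullet> c) *\<^sub>R c)"
        by (simp add: euclidean_representation)
      then show ?thesis
        by (simp add: blinfun.sum_right blinfun.scaleR_right inner_sum_left)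
    qed
    then show ?thesis by (simp add: lin_trace_def)
  qed
  show ?thesis unfolding *
    by (subst sum.swap) (simp add: mult.commute)
qed

lemma linear_lin_trace: "linear lin_trace"
  by (rule linearI) (simp_all add: lin_trace_def blinfun.add_left blinfun.scaleR_left inner_add_left
      sum.distrib sum_distrib_left)

section \<open>Automorphisms and the identity component\<close>

lemma lie_autD:
  assumes "g \<in> lie_aut br"
  shows "bij (blinfun_apply g)"
    and "blinfun_apply g (br X Y) = br (blinfun_apply g X) (blinfun_apply g Y)"
  using assms by (auto simp: lie_aut_def)

lemma lie_autI:
  assumes "g o\<^sub>L h = id_blinfun" "h o\<^sub>L g = id_blinfun"
    and "\<And>X Y. blinfun_apply g (br X Y) = br (blinfun_apply g X) (blinfun_apply g Y)"
  shows "g \<in> lie_aut br"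
  using assms bij_blinfunI by (auto simp: lie_aut_def)

lemma id_in_lie_aut: "id_blinfun \<in> lie_aut br"
  by (rule lie_autI[of _ id_blinfun]) (auto intro: blinfun_eqI)

lemma lie_aut_compose: "g \<in> lie_aut br \<Longrightarrow> h \<in> lie_aut br \<Longrightarrow> g o\<^sub>L h \<in> lie_aut br"
  using bij_comp[of "blinfun_apply h" "blinfun_apply g"]
  by (simp add: lie_aut_def comp_def blinfun_compose.rep_eq)

lemma lie_aut_inverse:
  assumes "g \<in> lie_aut br"
  obtains h where "h \<in> lie_aut br" "g o\<^sub>L h = id_blinfun" "h o\<^sub>L g = id_blinfun"
proof -
  obtain h where h: "g o\<^sub>L h = id_blinfun" "h o\<^sub>L g = id_blinfun"
    using bij_blinfun_inverse lie_autD(1)[OF assms] by blast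
  have gh: "blinfun_apply g (blinfun_apply h X) = X" for X
    using h(1) by (rule blinfun_compose_idD)
  have hg: "blinfun_apply h (blinfun_apply g X) = X" for X
    using h(2) by (rule blinfun_compose_idD)
  have "blinfun_apply h (br X Y) = br (blinfun_apply h X) (blinfun_apply h Y)" for X Y
    using lie_autD(2)[OF assms, of "blinfun_apply h X" "blinfun_apply h Y"] by (metis gh hg)
  with h show ?thesis using that lie_autI by blast
qed

text \<open>Left translation by \<open>g\<close> maps the identity component to a connected set of
  automorphisms through \<open>g\<close> and \<open>g o\<^sub>L h\<close>.\<close>

lemma connected_component_lie_aut_compose:
  assumes "connected_component (lie_aut br) id_blinfun g"
    and "connected_component (lie_aut br) id_blinfun h"
  shows "connected_component (lie_aut br) id_blinfun (g o\<^sub>L h)"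
proof -
  let ?C = "connected_component_set (lie_aut br) id_blinfun"
  have g: "g \<in> lie_aut br" using assms(1) connected_component_in by blast
  have "connected ((o\<^sub>L) g ` ?C)"
    by (intro connected_continuous_image continuous_intros connected_connected_component)
  moreover have "(o\<^sub>L) g ` ?C \<subseteq> lie_aut br"
    using g lie_aut_compose connected_component_in by blast
  moreover have "g \<in> (o\<^sub>L) g ` ?C"
    using id_in_lie_aut by (intro image_eqI[of _ _ id_blinfun]) (auto intro: blinfun_eqI)
  ultimately have "connected_component (lie_aut br) g (g o\<^sub>L h)"
    using assms(2) unfolding connected_component_def by blast
  then show ?thesis using assms(1) connected_component_trans by blast
qed

text \<open>The translate of the identity component by \<open>h\<close> contains \<open>h\<close>,
  as the image of the identity, and the identity, as the image of \<open>g\<close>.\<close>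

lemma connected_component_lie_aut_inverse:
  assumes "connected_component (lie_aut br) id_blinfun g"
    and h: "h \<in> lie_aut br" "h o\<^sub>L g = id_blinfun"
  shows "connected_component (lie_aut br) id_blinfun h"
proof -
  let ?C = "connected_component_set (lie_aut br) id_blinfun"
  have "connected ((o\<^sub>L) h ` ?C)"
    by (intro connected_continuous_image continuous_intros connected_connected_component)
  moreover have "(o\<^sub>L) h ` ?C \<subseteq> lie_aut br"
    using h lie_aut_compose connected_component_in by blast
  moreover have "h \<in> (o\<^sub>L) h ` ?C"
    using id_in_lie_aut by (intro image_eqI[of _ _ id_blinfun]) (auto intro: blinfun_eqI)
  moreover have "id_blinfun \<in> (o\<^sub>L) h ` ?C"
    using assms by (intro image_eqI[of _ _ g]) auto
  ultimately show ?thesis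
    unfolding connected_component_def by blast
qed

lemma carrier_Aut0: "carrier (Aut0 br) = connected_component_set (lie_aut br) id_blinfun"
  and mult_Aut0: "g \<otimes>\<^bsub>Aut0 br\<^esub> h = g o\<^sub>L h"
  and one_Aut0: "\<one>\<^bsub>Aut0 br\<^esub> = id_blinfun"
  by (simp_all add: Aut0_def)

lemma carrier_Aut0_subset: "carrier (Aut0 br) \<subseteq> lie_aut br"
  by (simp add: carrier_Aut0 connected_component_subset)

lemma group_Aut0: "group (Aut0 br)"
proof (rule groupI)
  fix g assume g: "g \<in> carrier (Aut0 br)"
  then obtain h where h: "h \<in> lie_aut br" "h o\<^sub>L g = id_blinfun"
    using carrier_Aut0_subset lie_aut_inverse by (metis subsetD)
  then show "\<exists>h\<in>carrier (Aut0 br). h \<otimes>\<^bsub>Aut0 br\<^esub> g = \<one>\<^bsub>Aut0 br\<^esub>"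
    using g connected_component_lie_aut_inverse by (force simp: carrier_Aut0 mult_Aut0 one_Aut0)
qed (auto simp: carrier_Aut0 mult_Aut0 one_Aut0 connected_component_lie_aut_compose id_in_lie_aut
    intro: blinfun_eqI)

lemma Aut0_inv:
  assumes "g \<in> carrier (Aut0 br)"
  shows "g o\<^sub>L inv\<^bsub>Aut0 br\<^esub> g = id_blinfun" "inv\<^bsub>Aut0 br\<^esub> g o\<^sub>L g = id_blinfun"
  using group.r_inv[OF group_Aut0 assms] group.l_inv[OF group_Aut0 assms]
  by (simp_all add: mult_Aut0 one_Aut0)

text \<open>The curve \<open>G\<close>, which applies \<open>exp (- t A)\<close> to the bracket of
  \<open>exp (t A) X\<close> and \<open>exp (t A) Y\<close>, has derivative zero because
  \<open>A\<close> is a derivation; compare \<open>t = 0\<close> and \<open>t = 1\<close>.\<close>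

lemma exp_blinfun_derivation_in_lie_aut:
  assumes br: "bounded_bilinear br"
    and der: "\<And>X Y. blinfun_apply A (br X Y) = br (blinfun_apply A X) Y + br X (blinfun_apply A Y)"
  shows "exp_blinfun A \<in> lie_aut br"
proof (rule lie_autI)
  show "exp_blinfun A o\<^sub>L exp_blinfun (- A) = id_blinfun"
    "exp_blinfun (- A) o\<^sub>L exp_blinfun A = id_blinfun"
    by (rule exp_blinfun_minus)+
  fix X Y
  define e where "e t = blinfun_apply (exp_blinfun (t *\<^sub>R A))" for t
  define G where "G t = blinfun_apply (exp_blinfun (t *\<^sub>R (- A))) (br (e t X) (e t Y))" for t
  have e: "((\<lambda>t. e t Z) has_vector_derivative blinfun_apply A (e t Z)) (at t)" for Z t
    using bounded_linear.has_vector_derivative[OF blinfun.bounded_linear_left[of Z]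
        exp_blinfun_has_vector_derivative(2)[of A t]] by (simp add: e_def)
  have "((\<lambda>t. br (e t X) (e t Y)) has_vector_derivative blinfun_apply A (br (e t X) (e t Y))) (at t)" for t
    using bounded_bilinear.has_vector_derivative[OF br e[of X t] e[of Y t]] by (simp add: der add.commute)
  then have "(G has_vector_derivative
      blinfun_apply (exp_blinfun (t *\<^sub>R (- A))) (blinfun_apply A (br (e t X) (e t Y)))
      + blinfun_apply (exp_blinfun (t *\<^sub>R (- A)) o\<^sub>L (- A)) (br (e t X) (e t Y))) (at t)" for t
    unfolding G_def
    by (rule bounded_bilinear.has_vector_derivative[OF bounded_bilinear_blinfun_apply
        exp_blinfun_has_vector_derivative(1)])
  then have "(G has_vector_derivative 0) (at t)" for t
    by (simp add: blinfun.minus_left blinfun.minus_right)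
  then have "G 1 = G 0"
    by (intro has_derivative_zero_unique[of UNIV G]) (auto simp: has_vector_derivative_def)
  then have "blinfun_apply (exp_blinfun (- A)) (br (e 1 X) (e 1 Y)) = br X Y"
    by (simp add: G_def e_def exp_blinfun_0)
  then have "blinfun_apply (exp_blinfun A o\<^sub>L exp_blinfun (- A)) (br (e 1 X) (e 1 Y))
      = blinfun_apply (exp_blinfun A) (br X Y)"
    by simp
  then show "blinfun_apply (exp_blinfun A) (br X Y)
      = br (blinfun_apply (exp_blinfun A) X) (blinfun_apply (exp_blinfun A) Y)"
    by (simp only: exp_blinfun_minus) (simp add: e_def)
qed

section \<open>The adjoint representation and the Killing form\<close>

locale lie_algebra =
  fixes br :: "'a::euclidean_space \<Rightarrow> 'a \<Rightarrow> 'a"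
  assumes lie_bracket: "lie_bracket br"
begin

lemma bilinear_br: "bilinear br" and br_self [simp]: "br X X = 0"
  and jacobi: "br X (br Y Z) + br Y (br Z X) + br Z (br X Y) = 0"
  using lie_bracket by (auto simp: lie_bracket_def)

sublocale br: bounded_bilinear br
  using bilinear_br by (simp add: bilinear_conv_bounded_bilinear)

lemma br_anticommute: "br X Y = - br Y X"
proof -
  have "br X Y + br Y X = br (X + Y) (X + Y)" unfolding br.add_left br.add_right by simp
  then have "br X Y + br Y X = 0" by simp
  then show ?thesis by (simp add: eq_neg_iff_add_eq_0)
qed

lemma br_derivation: "br X (br Y Z) = br (br X Y) Z + br Y (br X Z)"
  using jacobi[of X Y Z] br_anticommute[of Z "br X Y"] br_anticommute[of Z X]
  by (simp add: br.minus_right algebra_simps)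

lemma ad_apply [simp]: "blinfun_apply (ad br X) Y = br X Y"
  by (simp add: ad_def bounded_linear_Blinfun_apply br.bounded_linear_right)

lemma linear_ad: "linear (ad br)"
  by (rule linearI) (auto intro!: blinfun_eqI simp: blinfun.bilinear_simps br.add_left br.scaleR_left)

lemma ad_simps: "ad br (X + Y) = ad br X + ad br Y" "ad br (X - Y) = ad br X - ad br Y"
  "ad br (- X) = - ad br X" "ad br (c *\<^sub>R X) = c *\<^sub>R ad br X" "ad br 0 = 0"
  using linear_ad by (simp_all add: linear_add linear_diff linear_neg linear_scale linear_0)

lemma bounded_linear_ad: "bounded_linear (ad br)"
  using linear_ad by (simp add: linear_conv_bounded_linear)

lemma ad_br: "ad br (br X Y) = (ad br X o\<^sub>L ad br Y) - (ad br Y o\<^sub>L ad br X)"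
  by (rule blinfun_eqI) (simp add: blinfun.diff_left br_derivation[of X Y])

lemma lie_aut_ad: "g \<in> lie_aut br \<Longrightarrow> g o\<^sub>L ad br X = ad br (blinfun_apply g X) o\<^sub>L g"
  by (rule blinfun_eqI) (simp add: lie_autD)

lemma killing_commute: "killing br X Y = killing br Y X"
  unfolding killing_def by (rule lin_trace_commute)

lemma linear_killing_right: "linear (killing br X)"
  by (rule linearI) (simp_all add: killing_def ad_simps bounded_bilinear.add_right[OF bounded_bilinear_blinfun_compose]
      bounded_bilinear.scaleR_right[OF bounded_bilinear_blinfun_compose]
      linear_add[OF linear_lin_trace] linear_scale[OF linear_lin_trace])

lemma linear_killing_left: "linear (\<lambda>X. killing br X Y)"
  using linear_killing_right by (simp add: killing_commute[of _ Y])

lemma killing_invariant: "killing br (br X Y) Z = killing br X (br Y Z)"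
proof -
  have "killing br (br X Y) Z = lin_trace (ad br X o\<^sub>L ad br Y o\<^sub>L ad br Z) - lin_trace (ad br Y o\<^sub>L (ad br X o\<^sub>L ad br Z))"
    unfolding killing_def ad_br linear_diff[OF linear_lin_trace, symmetric]
    by (rule arg_cong[where f = lin_trace]) (auto intro: blinfun_eqI simp: blinfun.diff_left)
  also have "lin_trace (ad br Y o\<^sub>L (ad br X o\<^sub>L ad br Z)) = lin_trace (ad br X o\<^sub>L ad br Z o\<^sub>L ad br Y)"
    by (rule lin_trace_commute)
  also have "lin_trace (ad br X o\<^sub>L ad br Y o\<^sub>L ad br Z) - lin_trace (ad br X o\<^sub>L ad br Z o\<^sub>L ad br Y)
      = killing br X (br Y Z)"
    unfolding killing_def ad_br linear_diff[OF linear_lin_trace, symmetric]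
    by (rule arg_cong[where f = lin_trace])
      (auto intro: blinfun_eqI simp: blinfun.diff_left blinfun.diff_right br.diff_right)
  finally show ?thesis .
qed

lemma killing_lie_aut:
  assumes "g \<in> lie_aut br"
  shows "killing br (blinfun_apply g X) (blinfun_apply g Y) = killing br X Y"
proof -
  obtain h where h: "g o\<^sub>L h = id_blinfun" "h o\<^sub>L g = id_blinfun" using lie_aut_inverse[OF assms] by blast
  have hg: "blinfun_apply h (blinfun_apply g X) = X" for X
    using h(2) by (rule blinfun_compose_idD)
  have "lin_trace (ad br (blinfun_apply g X) o\<^sub>L ad br (blinfun_apply g Y))
      = lin_trace (ad br (blinfun_apply g X) o\<^sub>L ad br (blinfun_apply g Y) o\<^sub>L (g o\<^sub>L h))"
    unfolding h(1) by (rule arg_cong[where f = lin_trace], rule blinfun_eqI) simp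
  also have "\<dots> = lin_trace (g o\<^sub>L (ad br X o\<^sub>L ad br Y o\<^sub>L h))"
    by (rule arg_cong[where f = lin_trace], rule blinfun_eqI) (simp add: lie_autD[OF assms])
  also have "\<dots> = lin_trace (ad br X o\<^sub>L ad br Y o\<^sub>L h o\<^sub>L g)"
    by (rule lin_trace_commute)
  also have "\<dots> = lin_trace (ad br X o\<^sub>L ad br Y)"
    by (rule arg_cong[where f = lin_trace], rule blinfun_eqI) (simp add: hg)
  finally show ?thesis by (simp add: killing_def)
qed

lemma exp_ad_in_lie_aut: "exp_blinfun (ad br X) \<in> lie_aut br"
  using br.bounded_bilinear_axioms by (rule exp_blinfun_derivation_in_lie_aut) (simp, rule br_derivation)

lemma exp_ad_in_Aut0: "exp_blinfun (ad br X) \<in> carrier (Aut0 br)"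
proof -
  let ?f = "\<lambda>t. exp_blinfun (ad br (t *\<^sub>R X))"
  have "connected (?f ` {0..1})"
    by (intro connected_continuous_image continuous_on_compose2[OF continuous_on_exp_blinfun]
        bounded_linear.continuous_on[OF bounded_linear_ad] continuous_intros) auto
  moreover have "?f ` {0..1} \<subseteq> lie_aut br" using exp_ad_in_lie_aut by blast
  moreover have "id_blinfun \<in> ?f ` {0..1}" by (intro image_eqI[of _ _ 0]) (auto simp: ad_simps exp_blinfun_0)
  moreover have "exp_blinfun (ad br X) \<in> ?f ` {0..1}" by (intro image_eqI[of _ _ 1]) auto
  ultimately show ?thesis unfolding carrier_Aut0 connected_component_def by blast
qed

end

section \<open>Automorphisms near the identity\<close>

lemma bounded_linear_bound_ge_1:
  assumes "bounded_linear f"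
  obtains K where "K \<ge> 1" "\<And>x. norm (f x) \<le> K * norm x"
proof -
  obtain K where K: "\<And>x. norm (f x) \<le> norm x * K" using bounded_linear.bounded[OF assms] by blast
  have "norm (f x) \<le> max 1 K * norm x" for x
    using K[of x] mult_right_mono[of K "max 1 K" "norm x"] by (simp add: mult.commute)
  then show ?thesis by (intro that[of "max 1 K"]) auto
qed

text \<open>Nondegeneracy is what makes derivations inner. A Cartan involution yields it at once,
  from the positivity of \<open>B_form\<close>.\<close>

locale nondegenerate_lie_algebra = lie_algebra br
  for br :: "'a::euclidean_space \<Rightarrow> 'a \<Rightarrow> 'a" +
  assumes nondegenerate: "(\<And>Y. killing br X Y = 0) \<Longrightarrow> X = 0"
begin

text \<open>\<open>\<phi>\<close> represents the Killing form through the inner product of the type.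
  Nondegeneracy makes it injective, hence invertible in finite dimension, and \<open>\<psi>\<close>
  is its inverse.\<close>

lemma killing_dual:
  obtains \<psi> :: "'a \<Rightarrow> 'a" where "linear \<psi>" "\<And>Z Y. killing br (\<psi> Z) Y = Z \<bullet> Y"
proof -
  define \<phi> where "\<phi> X = (\<Sum>b\<in>Basis. killing br X b *\<^sub>R b)" for X
  have \<phi>: "\<phi> X \<bullet> Y = killing br X Y" for X Y
  proof -
    have "killing br X Y = killing br X (\<Sum>b\<in>Basis. (Y \<bullet> b) *\<^sub>R b)"
      by (simp add: euclidean_representation)
    also have "\<dots> = (\<Sum>b\<in>Basis. (Y \<bullet> b) * killing br X b)"
      by (simp add: linear_sum[OF linear_killing_right] linear_scale[OF linear_killing_right])
    finally show ?thesis
      by (simp add: \<phi>_def inner_sum_right mult.commute inner_commute[of _ Y])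
  qed
  have "linear \<phi>"
    by (rule linearI) (simp_all add: \<phi>_def linear_add[OF linear_killing_left] linear_scale[OF linear_killing_left]
        scaleR_add_left sum.distrib scaleR_sum_right)
  moreover have "inj \<phi>"
    unfolding linear_injective_0[OF \<open>linear \<phi>\<close>] using \<phi> nondegenerate by (metis inner_zero_left)
  ultimately obtain \<psi> where \<psi>: "linear \<psi>" "\<And>x. \<phi> (\<psi> x) = x"
    using linear_injective_isomorphism by metis
  have "killing br (\<psi> Z) Y = Z \<bullet> Y" for Z Y
    using \<phi>[of "\<psi> Z" Y] \<psi> by simp
  with \<psi>(1) show ?thesis by (rule that)
qed

lemma killing_eqI: "(\<And>Z. killing br X Z = killing br Y Z) \<Longrightarrow> X = Y"
  using nondegenerate[of "X - Y"] by (simp add: linear_diff[OF linear_killing_left])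

text \<open>\<open>P A\<close> is the Killing representative of the functional that sends
  \<open>Y\<close> to the trace of \<open>A o\<^sub>L ad br Y\<close>, so \<open>P\<close> is a left
  inverse of \<open>ad br\<close>. That a derivation in its kernel is zero is the core of the
  classical proof that derivations are inner.\<close>

lemma ad_projection:
  obtains P :: "('a \<Rightarrow>\<^sub>L 'a) \<Rightarrow> 'a"
  where "bounded_linear P" "\<And>X. P (ad br X) = X"
    and "\<And>D. (\<And>X Y. blinfun_apply D (br X Y) = br (blinfun_apply D X) Y + br X (blinfun_apply D Y))
      \<Longrightarrow> P D = 0 \<Longrightarrow> D = 0"
proof -
  obtain \<psi> :: "'a \<Rightarrow> 'a" where \<psi>: "linear \<psi>" "\<And>Z Y. killing br (\<psi> Z) Y = Z \<bullet> Y"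
    using killing_dual by blast
  define P where "P A = \<psi> (\<Sum>b\<in>Basis. lin_trace (A o\<^sub>L ad br b) *\<^sub>R b)" for A
  have trace_bl: "bounded_linear (\<lambda>A::'a \<Rightarrow>\<^sub>L 'a. lin_trace (A o\<^sub>L B))" for B
    unfolding lin_trace_def blinfun_apply_blinfun_compose
    by (intro bounded_linear_sum bounded_linear_inner_left_comp blinfun.bounded_linear_left)
  have "bounded_linear P"
    unfolding P_def
  proof (rule bounded_linear_compose[of \<psi>])
    show "bounded_linear \<psi>" using \<psi>(1) by (simp add: linear_conv_bounded_linear)
  qed (intro bounded_linear_sum bounded_linear_scaleR_const trace_bl)
  moreover have kP: "killing br (P A) Y = lin_trace (A o\<^sub>L ad br Y)" for A Y
  proof -
    have "ad br Y = ad br (\<Sum>b\<in>Basis. (Y \<bullet> b) *\<^sub>R b)" by (simp add: euclidean_representation)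
    also have "\<dots> = (\<Sum>b\<in>Basis. (Y \<bullet> b) *\<^sub>R ad br b)"
      by (simp add: linear_sum[OF linear_ad] ad_simps)
    finally have "A o\<^sub>L ad br Y = (\<Sum>b\<in>Basis. (Y \<bullet> b) *\<^sub>R (A o\<^sub>L ad br b))"
      by (auto intro!: blinfun_eqI simp: blinfun.bilinear_simps blinfun.sum_left blinfun.sum_right)
    then show ?thesis
      by (simp add: P_def \<psi>(2) inner_sum_right linear_sum[OF linear_lin_trace]
          linear_scale[OF linear_lin_trace] inner_commute[of _ Y] mult.commute)
  qed
  moreover have "P (ad br X) = X" for X
    by (rule killing_eqI) (simp only: kP, simp only: killing_def)
  moreover have "D = 0"
    if der: "\<And>X Y. blinfun_apply D (br X Y) = br (blinfun_apply D X) Y + br X (blinfun_apply D Y)"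
      and "P D = 0" for D
  proof (rule blinfun_eqI)
    fix X
    have tr: "lin_trace (D o\<^sub>L ad br Y) = 0" for Y
      using kP[of D Y] \<open>P D = 0\<close> by (simp add: linear_0[OF linear_killing_left])
    have "killing br (blinfun_apply D X) Y = 0" for Y
    proof -
      \<comment> \<open>For a derivation, \<open>ad (D X)\<close> is the commutator of
        \<open>D\<close> and \<open>ad X\<close>. Cyclicity of the trace moves the commutator onto
        \<open>ad X\<close> and \<open>ad Y\<close>, leaving the trace of \<open>D\<close> with
        \<open>ad [X, Y]\<close>, which is zero.\<close>
      have "ad br (blinfun_apply D X) o\<^sub>L ad br Y = (D o\<^sub>L (ad br X o\<^sub>L ad br Y)) - (ad br X o\<^sub>L D o\<^sub>L ad br Y)"
        by (rule blinfun_eqI) (simp add: der blinfun.bilinear_simps)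
      then have "killing br (blinfun_apply D X) Y
          = lin_trace (D o\<^sub>L (ad br X o\<^sub>L ad br Y)) - lin_trace (ad br X o\<^sub>L (D o\<^sub>L ad br Y))"
        by (simp add: killing_def linear_diff[OF linear_lin_trace])
          (rule arg_cong[where f = lin_trace], auto intro: blinfun_eqI)
      also have "lin_trace (ad br X o\<^sub>L (D o\<^sub>L ad br Y)) = lin_trace ((D o\<^sub>L ad br Y) o\<^sub>L ad br X)"
        by (rule lin_trace_commute)
      also have "lin_trace (D o\<^sub>L (ad br X o\<^sub>L ad br Y)) - \<dots> = lin_trace (D o\<^sub>L ad br (br X Y))"
        unfolding linear_diff[OF linear_lin_trace, symmetric]
        by (rule arg_cong[where f = lin_trace], rule blinfun_eqI)
          (simp add: ad_br blinfun.bilinear_simps)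
      finally show ?thesis using tr by simp
    qed
    then show "blinfun_apply D X = blinfun_apply 0 X" using nondegenerate by simp
  qed
  ultimately show ?thesis using that by blast
qed

text \<open>The difference of an automorphism and the identity is a derivation up to a quadratic error.\<close>

lemma lie_aut_near_id_eq_id:
  fixes P :: "('a \<Rightarrow>\<^sub>L 'a) \<Rightarrow> 'a"
  assumes P: "bounded_linear P"
    and inner: "\<And>D. (\<And>X Y. blinfun_apply D (br X Y) = br (blinfun_apply D X) Y + br X (blinfun_apply D Y))
      \<Longrightarrow> P D = 0 \<Longrightarrow> D = 0"
  obtains e where "e > 0"
    "\<And>h. h \<in> lie_aut br \<Longrightarrow> norm (h - id_blinfun) < e \<Longrightarrow> P (h - id_blinfun) = 0 \<Longrightarrow> h = id_blinfun"
proof (rule ccontr)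
  assume "\<not> thesis"
  then have "\<exists>h\<in>lie_aut br. norm (h - id_blinfun) < 1 / real (Suc n) \<and> P (h - id_blinfun) = 0 \<and> h \<noteq> id_blinfun"
    for n using that[of "1 / real (Suc n)"] by fastforce
  then obtain h where h: "\<And>n. h n \<in> lie_aut br" "\<And>n. norm (h n - id_blinfun) < 1 / real (Suc n)"
    "\<And>n. P (h n - id_blinfun) = 0" "\<And>n. h n \<noteq> id_blinfun"
    by metis
  \<comment> \<open>The automorphisms \<open>h n\<close> tend to the identity with displacements in
    the kernel of \<open>P\<close>. The normalised displacements \<open>E n\<close> subconverge on
    the unit sphere to a derivation \<open>L\<close> with \<open>P L = 0\<close>, a
    contradiction.\<close>
  define d where "d n = norm (h n - id_blinfun)" for n
  define E where "E n = (h n - id_blinfun) /\<^sub>R d n" for n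
  have d: "d n > 0" for n using h(4) by (simp add: d_def)
  have "d \<longlonglongrightarrow> 0"
  proof (rule tendsto_sandwich[of "\<lambda>_. 0" d _ "\<lambda>n. 1 / real (Suc n)"])
    show "(\<lambda>n. 1 / real (Suc n)) \<longlonglongrightarrow> 0" using LIMSEQ_inverse_real_of_nat by (simp add: inverse_eq_divide)
  qed (use d h(2) in \<open>auto simp: d_def less_imp_le\<close>)
  have hE: "blinfun_apply (h n) X = X + d n *\<^sub>R blinfun_apply (E n) X" for n X
    using d[of n] by (simp add: E_def blinfun.bilinear_simps)
  \<comment> \<open>Expanding \<open>h n [X, Y] = [h n X, h n Y]\<close> and dividing by
    \<open>d n\<close> leaves the derivation rule up to a term with a factor \<open>d n\<close>,
    which disappears in the limit.\<close>
  have E: "blinfun_apply (E n) (br X Y) - br (blinfun_apply (E n) X) Y - br X (blinfun_apply (E n) Y)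
      = d n *\<^sub>R br (blinfun_apply (E n) X) (blinfun_apply (E n) Y)" for n X Y
  proof -
    have "d n *\<^sub>R blinfun_apply (E n) (br X Y) = d n *\<^sub>R (br X (blinfun_apply (E n) Y) + br (blinfun_apply (E n) X) Y
        + d n *\<^sub>R br (blinfun_apply (E n) X) (blinfun_apply (E n) Y))"
      using lie_autD(2)[OF h(1)[of n], of X Y]
      by (simp add: hE br.add_left br.add_right br.scaleR_left br.scaleR_right scaleR_add_right)
    then have "blinfun_apply (E n) (br X Y) = br X (blinfun_apply (E n) Y) + br (blinfun_apply (E n) X) Y
        + d n *\<^sub>R br (blinfun_apply (E n) X) (blinfun_apply (E n) Y)"
      unfolding scaleR_cancel_left using d[of n] by simp
    then show ?thesis by (simp add: algebra_simps)
  qed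
  have PE: "P (E n) = 0" for n
    by (simp add: E_def linear_scale[OF bounded_linear.linear[OF P]] h(3))
  have compact: "compact (sphere (0 :: 'a \<Rightarrow>\<^sub>L 'a) 1)"
  proof -
    have "closed {A :: 'a \<Rightarrow>\<^sub>L 'a. norm A = 1}"
      by (intro closed_Collect_eq continuous_intros)
    then show ?thesis
      unfolding compact_eq_bounded_closed by (auto simp: sphere_def bounded_iff intro!: exI[of _ 1])
  qed
  have "E n \<in> sphere 0 1" for n
    using d[of n] by (simp add: E_def flip: d_def)
  then obtain L s where s: "strict_mono s" "(E \<circ> s) \<longlonglongrightarrow> L" and L: "L \<in> sphere 0 1"
    using compact unfolding compact_def by metis
  have lim: "(\<lambda>n. E (s n)) \<longlonglongrightarrow> L" using s(2) by (simp add: comp_def)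
  have "P L = 0"
    using tendsto_unique[OF _ bounded_linear.tendsto[OF P lim], of 0] by (simp add: PE)
  moreover have "blinfun_apply L (br X Y) = br (blinfun_apply L X) Y + br X (blinfun_apply L Y)" for X Y
  proof -
    have ds: "(\<lambda>n. d (s n)) \<longlonglongrightarrow> 0"
      using LIMSEQ_subseq_LIMSEQ[OF \<open>d \<longlonglongrightarrow> 0\<close> s(1)] by (simp add: comp_def)
    have "(\<lambda>n. d (s n) *\<^sub>R br (blinfun_apply (E (s n)) X) (blinfun_apply (E (s n)) Y))
        \<longlonglongrightarrow> 0 *\<^sub>R br (blinfun_apply L X) (blinfun_apply L Y)"
      by (intro tendsto_intros ds lim br.tendsto)
    moreover have "(\<lambda>n. d (s n) *\<^sub>R br (blinfun_apply (E (s n)) X) (blinfun_apply (E (s n)) Y))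
        \<longlonglongrightarrow> blinfun_apply L (br X Y) - br (blinfun_apply L X) Y - br X (blinfun_apply L Y)"
      unfolding E[symmetric] by (intro tendsto_intros lim br.tendsto)
    ultimately have "blinfun_apply L (br X Y) - br (blinfun_apply L X) Y - br X (blinfun_apply L Y) = 0"
      using LIMSEQ_unique by fastforce
    then show ?thesis by (simp add: algebra_simps)
  qed
  ultimately have "L = 0" using inner by blast
  with L show False by simp
qed

text \<open>A factorisation of \<open>g\<close> is a zero of the displacement of \<open>exp (- \<pi>\<^sub>1 X) g exp (- \<pi>\<^sub>2 X)\<close> from the
  identity. As this displacement is nearly \<open>- ad X\<close>, Brouwer's theorem supplies a zero of its
  projection to the inner derivations, and the preceding lemma applies.\<close>

lemma lie_aut_local_factorization:
  fixes \<pi>1 \<pi>2 :: "'a \<Rightarrow> 'a"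
  assumes \<pi>: "linear \<pi>1" "linear \<pi>2" "\<And>X. \<pi>1 X + \<pi>2 X = X" and "\<epsilon> > 0"
  obtains \<delta> where "\<delta> > 0"
    "\<And>g. g \<in> lie_aut br \<Longrightarrow> norm (g - id_blinfun) < \<delta> \<Longrightarrow>
      \<exists>X. norm X \<le> \<epsilon> \<and> g = exp_blinfun (ad br (\<pi>1 X)) o\<^sub>L exp_blinfun (ad br (\<pi>2 X))"
proof -
  obtain P :: "('a \<Rightarrow>\<^sub>L 'a) \<Rightarrow> 'a" where P: "bounded_linear P" "\<And>X. P (ad br X) = X"
    and inner: "\<And>D. (\<And>X Y. blinfun_apply D (br X Y) = br (blinfun_apply D X) Y + br X (blinfun_apply D Y))
      \<Longrightarrow> P D = 0 \<Longrightarrow> D = 0"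
    using ad_projection by blast
  obtain e where e: "e > 0"
    "\<And>h. h \<in> lie_aut br \<Longrightarrow> norm (h - id_blinfun) < e \<Longrightarrow> P (h - id_blinfun) = 0 \<Longrightarrow> h = id_blinfun"
    using lie_aut_near_id_eq_id[OF P(1) inner] by blast
  have bl: "bounded_linear (\<lambda>X. ad br (\<pi>1 X))" "bounded_linear (\<lambda>X. ad br (\<pi>2 X))"
    using \<pi> by (auto intro: bounded_linear_compose[OF bounded_linear_ad] simp: linear_conv_bounded_linear)
  obtain N where N: "N \<ge> 1" "\<And>A. norm (P A) \<le> N * norm A"
    using bounded_linear_bound_ge_1[OF P(1)] by blast
  obtain M1 M2 where "M1 \<ge> 1" "M2 \<ge> 1"
    and "\<And>X. norm (ad br (\<pi>1 X)) \<le> M1 * norm X" "\<And>X. norm (ad br (\<pi>2 X)) \<le> M2 * norm X"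
    using bl[THEN bounded_linear_bound_ge_1] by metis
  then obtain M where M: "M \<ge> 1" "\<And>X. norm (ad br (\<pi>1 X)) \<le> M * norm X" "\<And>X. norm (ad br (\<pi>2 X)) \<le> M * norm X"
    by (intro that[of "max M1 M2"])
      (auto intro: order_trans[OF _ mult_right_mono[OF max.cobounded1]] order_trans[OF _ mult_right_mono[OF max.cobounded2]])
  \<comment> \<open>The first bound on \<open>r\<close> and the first on \<open>\<delta>\<close>
    each allot \<open>r / 2\<close> to the displacement, so that Brouwer's map preserves the ball of
    radius \<open>r\<close>. The others keep \<open>h X\<close> within \<open>e\<close> of the
    identity: the sum \<open>6 * (M * r)\<^sup>2 + 2 * (M * r)\<close> is at most
    \<open>8 * (M * r)\<close>, less than \<open>e / 2\<close> as \<open>17 > 16\<close>, and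
    \<open>9 * \<delta>\<close> is at most \<open>e / 2\<close>.\<close>
  define r where "r = min \<epsilon> (min (1 / (12 * N * M\<^sup>2)) (e / (17 * M)))"
  define \<delta> where "\<delta> = min (r / (18 * N)) (e / 18)"
  have r: "r > 0" "r \<le> \<epsilon>" using M N e \<open>\<epsilon> > 0\<close> by (auto simp: r_def)
  have rN: "12 * N * M\<^sup>2 * r \<le> 1"
  proof -
    have "12 * N * M\<^sup>2 > 0" using M N by auto
    moreover have "r \<le> 1 / (12 * N * M\<^sup>2)" by (simp add: r_def)
    ultimately show ?thesis by (simp add: field_simps)
  qed
  have re: "17 * (M * r) \<le> e"
  proof -
    have "r \<le> e / (17 * M)" by (simp add: r_def)
    then show ?thesis using M by (simp add: field_simps)
  qed
  have Mr: "M * r \<le> 1" "0 \<le> M * r"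
  proof -
    have "M * r \<le> M\<^sup>2 * r" using M r by (simp add: power2_eq_square)
    also have "\<dots> \<le> 12 * N * M\<^sup>2 * r" using M N r by (simp add: mult_right_mono)
    finally show "M * r \<le> 1" using rN by simp
    show "0 \<le> M * r" using M r by simp
  qed
  have \<delta>: "\<delta> > 0" "18 * N * \<delta> \<le> r" "18 * \<delta> \<le> e"
  proof -
    show "\<delta> > 0" using r N e by (simp add: \<delta>_def)
    have "\<delta> \<le> r / (18 * N)" by (simp add: \<delta>_def)
    then show "18 * N * \<delta> \<le> r" using N by (simp add: field_simps)
    show "18 * \<delta> \<le> e" by (simp add: \<delta>_def)
  qed
  show ?thesis
  proof (rule that[OF \<delta>(1)])
    fix g assume g: "g \<in> lie_aut br" "norm (g - id_blinfun) < \<delta>"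
    define h where "h X = exp_blinfun (- ad br (\<pi>1 X)) o\<^sub>L g o\<^sub>L exp_blinfun (- ad br (\<pi>2 X))" for X
    have h_aut: "h X \<in> lie_aut br" for X
      using g(1) exp_ad_in_lie_aut[of "- \<pi>1 X"] exp_ad_in_lie_aut[of "- \<pi>2 X"]
      by (simp add: h_def ad_simps lie_aut_compose)
    have est: "norm (h X - id_blinfun + ad br X) \<le> 6 * (M * r)\<^sup>2 + 9 * \<delta>" if "norm X \<le> r" for X
    proof -
      have "M * norm X \<le> M * r" using that M by (simp add: mult_left_mono)
      then have "norm (ad br (\<pi>1 X)) \<le> M * r" "norm (ad br (\<pi>2 X)) \<le> M * r"
        using M(2,3)[of X] by linarith+
      from norm_exp_blinfun_product_estimate[OF this Mr(1), of g]
      have "norm (h X - id_blinfun + (ad br (\<pi>1 X) + ad br (\<pi>2 X))) \<le> 6 * (M * r)\<^sup>2 + 9 * norm (g - id_blinfun)"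
        by (simp add: h_def add.assoc)
      then show ?thesis using g(2) by (simp add: \<pi>(3) flip: ad_simps(1))
    qed
    have "continuous_on S h" for S
      unfolding h_def
      by (intro continuous_intros continuous_on_compose2[OF continuous_on_exp_blinfun[of UNIV]]
          bounded_linear.continuous_on[OF bl(1)] bounded_linear.continuous_on[OF bl(2)]) auto
    then have "continuous_on (cball 0 r) (\<lambda>X. X + P (h X - id_blinfun))"
      by (intro continuous_intros bounded_linear.continuous_on[OF P(1)])
    moreover have "X + P (h X - id_blinfun) \<in> cball 0 r" if "X \<in> cball 0 r" for X
    proof -
      \<comment> \<open>Since \<open>P (ad X) = X\<close>, the map is \<open>P\<close> applied to
        the quantity estimated in \<open>est\<close>, in which the linear terms in \<open>X\<close>
        have cancelled.\<close>
      have "X + P (h X - id_blinfun) = P (h X - id_blinfun + ad br X)"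
        by (simp add: linear_add[OF bounded_linear.linear[OF P(1)]] P(2))
      then have "norm (X + P (h X - id_blinfun)) \<le> N * (6 * (M * r)\<^sup>2 + 9 * \<delta>)"
        using N(2)[of "h X - id_blinfun + ad br X"] est[of X] that N(1)
        by (smt (verit) mem_cball_0 mult_left_mono)
      also have "\<dots> = (12 * N * M\<^sup>2 * r) * r / 2 + 18 * N * \<delta> / 2"
        by (simp add: power2_eq_square algebra_simps)
      also have "\<dots> \<le> 1 * r / 2 + r / 2"
        using rN \<delta>(2) r by (intro add_mono divide_right_mono mult_right_mono) auto
      finally show ?thesis by simp
    qed
    ultimately obtain X where X: "X \<in> cball 0 r" "X + P (h X - id_blinfun) = X"
      using brouwer_ball[OF r(1), of 0 "\<lambda>X. X + P (h X - id_blinfun)"] by blast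
    have "norm (h X - id_blinfun) < e"
    proof -
      have X': "norm X \<le> r" using X by simp
      have "norm (ad br X) \<le> 2 * (M * r)"
      proof -
        have "norm (ad br X) \<le> norm (ad br (\<pi>1 X)) + norm (ad br (\<pi>2 X))"
          using norm_triangle_ineq[of "ad br (\<pi>1 X)" "ad br (\<pi>2 X)"] by (simp add: \<pi>(3) flip: ad_simps(1))
        moreover have "M * norm X \<le> M * r" using X' M by (simp add: mult_left_mono)
        ultimately show ?thesis using M(2,3)[of X] by linarith
      qed
      moreover have "norm (h X - id_blinfun) \<le> norm (h X - id_blinfun + ad br X) + norm (ad br X)"
        using norm_triangle_ineq4[of "h X - id_blinfun + ad br X" "ad br X"] by simp
      moreover have "(M * r)\<^sup>2 \<le> M * r" using Mr by (simp add: power2_eq_square mult_left_le)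
      moreover have "0 < M * r" using M r by simp
      ultimately show ?thesis using est[OF X'] \<delta>(3) re by linarith
    qed
    then have "h X = id_blinfun" using e(2) h_aut X(2) by simp
    then have "exp_blinfun (ad br (\<pi>1 X)) o\<^sub>L h X o\<^sub>L exp_blinfun (ad br (\<pi>2 X))
        = exp_blinfun (ad br (\<pi>1 X)) o\<^sub>L exp_blinfun (ad br (\<pi>2 X))"
      by (auto intro: blinfun_eqI)
    moreover have "exp_blinfun (ad br (\<pi>1 X)) o\<^sub>L h X o\<^sub>L exp_blinfun (ad br (\<pi>2 X)) = g"
      by (rule blinfun_eqI) (simp add: h_def exp_blinfun_minus[THEN blinfun_compose_idD])
    ultimately show "\<exists>X. norm X \<le> \<epsilon> \<and> g = exp_blinfun (ad br (\<pi>1 X)) o\<^sub>L exp_blinfun (ad br (\<pi>2 X))"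
      using X(1) r(2) by (intro exI[of _ X]) auto
  qed
qed

end

section \<open>Simultaneous diagonalization\<close>

lemma linear_coeff_zero_of_nonneg_quadratic:
  fixes c d :: real
  assumes "\<And>t. 0 \<le> 2 * t * c + t\<^sup>2 * d"
  shows "c = 0"
proof (rule ccontr)
  assume "c \<noteq> 0"
  \<comment> \<open>A positive majorant of \<open>d\<close>, so that the minimiser
    \<open>- c / m\<close> serves whatever the sign of \<open>d\<close>.\<close>
  define m where "m = \<bar>d\<bar> + 1"
  have m: "m > 0" "d \<le> m" by (auto simp: m_def)
  define t where "t = - c / m"
  have "2 * t * c + t\<^sup>2 * d \<le> 2 * t * c + t\<^sup>2 * m"
    using m by (intro add_left_mono mult_left_mono) auto
  also have "\<dots> = - (c\<^sup>2 / m)"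
    using m(1) by (simp add: t_def power2_eq_square)
  also have "\<dots> < 0" using \<open>c \<noteq> 0\<close> m(1) by simp
  finally show False using assms[of t] by simp
qed

text \<open>To be instantiated by \<open>B_form\<close>: \<open>ad A\<close> with \<open>A\<close>
  in \<open>cartan_s \<theta>\<close> is symmetric for it, but in general not for the inner product
  of the type.\<close>

locale euclidean_form =
  fixes B :: "'a::euclidean_space \<Rightarrow> 'a \<Rightarrow> real"
  assumes bilinear_form: "bilinear B"
    and form_commute: "B x y = B y x"
    and form_pos: "x \<noteq> 0 \<Longrightarrow> B x x > 0"
begin

sublocale B: bounded_bilinear B
  using bilinear_form by (simp add: bilinear_conv_bounded_bilinear)

lemma form_eq_0_iff: "B x x = 0 \<longleftrightarrow> x = 0"
  using form_pos[of x] B.zero_left by force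

lemma form_eqI:
  assumes "\<And>z. B x z = B y z"
  shows "x = y"
  using form_eq_0_iff[of "x - y"] assms[of "x - y"] by (simp add: B.diff_left)

text \<open>The form attains a positive minimum on the compact unit sphere. This turns invariance of
  the form into a bound for the operator norm.\<close>

lemma form_lower_bound: obtains c where "c > 0" "\<And>x. c * (norm x)\<^sup>2 \<le> B x x"
proof -
  have "\<exists>x\<in>sphere 0 1. \<forall>y\<in>sphere 0 1. B x x \<le> B y y"
    by (rule continuous_attains_inf) (auto intro!: B.continuous_on continuous_intros)
  then obtain x0 where x0: "norm x0 = 1" "\<And>y. norm y = 1 \<Longrightarrow> B x0 x0 \<le> B y y" by auto
  have "B x0 x0 * (norm x)\<^sup>2 \<le> B x x" for x
  proof (cases "x = 0")
    case False
    then show ?thesis using x0(2)[of "x /\<^sub>R norm x"]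
      by (simp add: B.scaleR_left B.scaleR_right power2_eq_square field_simps)
  qed (simp add: B.zero_left)
  moreover have "B x0 x0 > 0" using x0(1) by (intro form_pos) auto
  ultimately show ?thesis using that by blast
qed

lemma form_projection:
  obtains y where "y \<in> span S" "\<And>u. u \<in> span S \<Longrightarrow> B (x - y) u = 0"
proof -
  obtain T where T: "T \<subseteq> span S" "span T = span S" "finite T"
    by (metis basis_subspace_exists finiteI_independent subspace_span)
  have "\<exists>y\<in>span T. \<forall>u\<in>span T. B (x - y) u = 0"
    using \<open>finite T\<close>
  proof (induction T arbitrary: x rule: finite_induct)
    case (insert a T)
    obtain p where p: "p \<in> span T" "\<And>u. u \<in> span T \<Longrightarrow> B (a - p) u = 0"
      using insert.IH by blast
    obtain q where q: "q \<in> span T" "\<And>u. u \<in> span T \<Longrightarrow> B (x - q) u = 0"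
      using insert.IH by blast
    have sub: "u \<in> span (insert a T)" if "u \<in> span T" for u
      using that span_mono[of T "insert a T"] by blast
    \<comment> \<open>The Gram-Schmidt coefficient. If \<open>a\<close> already lies in
      \<open>span T\<close>, then \<open>a - p\<close> is zero and the quotient is
      \<open>0 / 0 = 0\<close>, for which the equation \<open>c\<close> still holds.\<close>
    define c where "c = B x (a - p) / B (a - p) (a - p)"
    have c: "c * B (a - p) (a - p) = B x (a - p)"
      by (cases "a - p = 0") (simp_all add: c_def form_eq_0_iff B.zero_right)
    define y where "y = q + c *\<^sub>R (a - p)"
    have y: "y \<in> span (insert a T)"
      unfolding y_def using sub p q
      by (intro span_add span_scale span_diff) (auto intro: span_base)
    have yT: "B (x - y) u = 0" if "u \<in> span T" for u
      using q(2)[OF that] p(2)[OF that]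
      by (simp add: y_def B.add_left B.diff_left B.scaleR_left)
    have ya: "B (x - y) (a - p) = 0"
      using c p(2)[OF q(1)] by (simp add: y_def B.add_left B.diff_left B.scaleR_left form_commute[of q])
    have "B (x - y) u = 0" if u: "u \<in> span (insert a T)" for u
    proof -
      obtain k where k: "u - k *\<^sub>R a \<in> span T" using u by (auto simp: span_breakdown_eq)
      have "u = (u - k *\<^sub>R a) + k *\<^sub>R p + k *\<^sub>R (a - p)" by (simp add: algebra_simps)
      then have "B (x - y) u = B (x - y) (u - k *\<^sub>R a) + k * B (x - y) p + k * B (x - y) (a - p)"
        by (metis B.add_right B.scaleR_right real_scaleR_def)
      then show ?thesis using yT[OF k] yT[OF p(1)] ya by simp
    qed
    with y show ?case by blast
  qed (auto intro: span_zero simp: B.zero_right)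
  with T(2) show ?thesis using that by auto
qed

text \<open>A maximiser of the Rayleigh quotient is an eigenvector. The quotient is homogeneous of
  degree zero, so it may be maximised over the unit sphere of the ambient norm.\<close>

lemma symmetric_eigenvector_exists:
  assumes A: "linear A" "\<And>x y. B (A x) y = B x (A y)"
    and W: "subspace W" "\<And>x. x \<in> W \<Longrightarrow> A x \<in> W" "W \<noteq> {0}"
  obtains x l where "x \<in> W" "x \<noteq> 0" "A x = l *\<^sub>R x"
proof -
  have "\<exists>x\<in>W \<inter> sphere 0 1. \<forall>y\<in>W \<inter> sphere 0 1. B (A y) y / B y y \<le> B (A x) x / B x x"
  proof (rule continuous_attains_sup)
    show "compact (W \<inter> sphere 0 1)"
      using closed_subspace[OF W(1)] by (intro closed_Int_compact) auto
    obtain w where "w \<in> W" "w \<noteq> 0" using W subspace_0 by blast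
    then have "w /\<^sub>R norm w \<in> W \<inter> sphere 0 1" using W(1) by (auto intro: subspace_scale)
    then show "W \<inter> sphere 0 1 \<noteq> {}" by blast
    have nz: "B y y \<noteq> 0" if "y \<in> W \<inter> sphere 0 1" for y
      using that form_eq_0_iff[of y] by auto
    show "continuous_on (W \<inter> sphere 0 1) (\<lambda>y. B (A y) y / B y y)"
      using A(1) nz by (intro continuous_on_divide B.continuous_on continuous_on_id
          linear_continuous_on) (auto simp: linear_conv_bounded_linear)
  qed
  then obtain x where x: "x \<in> W" "norm x = 1"
    and max: "\<And>y. y \<in> W \<Longrightarrow> norm y = 1 \<Longrightarrow> B (A y) y / B y y \<le> B (A x) x / B x x"
    by auto
  define l where "l = B (A x) x / B x x"
  have nz: "x \<noteq> 0" using x by auto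
  have le: "B (A y) y \<le> l * B y y" if "y \<in> W" for y
  proof (cases "y = 0")
    case False
    define u where "u = y /\<^sub>R norm y"
    have y: "y = norm y *\<^sub>R u" "u \<noteq> 0" using False by (auto simp: u_def)
    have "u \<in> W" "norm u = 1" using that W(1) False by (auto simp: u_def intro: subspace_scale)
    then have "B (A u) u \<le> l * B u u"
      using max[of u] form_pos[OF y(2)] by (simp add: l_def[symmetric] pos_divide_le_eq)
    then have "(norm y)\<^sup>2 * B (A u) u \<le> (norm y)\<^sup>2 * (l * B u u)" by (intro mult_left_mono) auto
    moreover have "B (A y) y = (norm y)\<^sup>2 * B (A u) u" "B y y = (norm y)\<^sup>2 * B u u"
      by (subst (1 2) y(1); simp add: linear_scale[OF A(1)] B.scaleR_left B.scaleR_right power2_eq_square)+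
    ultimately show ?thesis by (simp add: mult.left_commute)
  qed (simp add: linear_0[OF A(1)] B.zero_left)
  \<comment> \<open>The form \<open>l * B y y - B (A y) y\<close> is non-negative on
    \<open>W\<close> and vanishes at \<open>x\<close>. Its derivative at \<open>x\<close> in
    direction \<open>z\<close> is \<open>2 * B z z\<close>, hence zero.\<close>
  define z where "z = l *\<^sub>R x - A x"
  have z: "z \<in> W" using x W by (simp add: z_def subspace_diff subspace_scale)
  have "B z z = 0"
  proof (rule linear_coeff_zero_of_nonneg_quadratic)
    fix t :: real
    have "x + t *\<^sub>R z \<in> W" using x z W(1) by (simp add: subspace_add subspace_scale)
    from le[OF this] have "0 \<le> l * B (x + t *\<^sub>R z) (x + t *\<^sub>R z) - B (A (x + t *\<^sub>R z)) (x + t *\<^sub>R z)" by simp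
    also have "\<dots> = (l * B x x - B (A x) x) + t * (l * B x z - B (A x) z) + t * (l * B z x - B (A z) x)
        + t\<^sup>2 * (l * B z z - B (A z) z)"
      by (simp add: linear_add[OF A(1)] linear_scale[OF A(1)] B.add_left B.add_right B.scaleR_left
          B.scaleR_right algebra_simps power2_eq_square)
    also have "l * B x x - B (A x) x = 0" using form_pos[OF nz] by (simp add: l_def)
    also have "l * B x z - B (A x) z = B z z" by (simp add: z_def B.diff_left B.scaleR_left)
    also have "l * B z x - B (A z) x = B z z"
      unfolding A(2) using B.diff_right[of z "l *\<^sub>R x" "A x"]
      by (simp add: B.scaleR_right flip: z_def)
    finally show "0 \<le> 2 * t * B z z + t\<^sup>2 * (l * B z z - B (A z) z)" by simp
  qed
  then have "A x = l *\<^sub>R x" by (simp add: form_eq_0_iff z_def)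
  with x(1) nz show ?thesis by (rule that)
qed

text \<open>Induction on the dimension. If some \<open>A\<close> in \<open>F\<close> is not scalar
  on \<open>W\<close>, an eigenspace \<open>W1\<close> of \<open>A\<close> and its orthogonal
  complement \<open>W2\<close> are proper subspaces, invariant under \<open>F\<close> by
  commutativity and symmetry respectively.\<close>

lemma commuting_symmetric_joint_eigenvectors:
  assumes F: "\<And>A. A \<in> F \<Longrightarrow> linear A" "\<And>A x y. A \<in> F \<Longrightarrow> B (A x) y = B x (A y)"
    "\<And>A A' x. A \<in> F \<Longrightarrow> A' \<in> F \<Longrightarrow> A (A' x) = A' (A x)"
    and W: "subspace W" "\<And>A x. A \<in> F \<Longrightarrow> x \<in> W \<Longrightarrow> A x \<in> W"
  shows "W \<subseteq> span {x \<in> W. \<forall>A\<in>F. \<exists>l. A x = l *\<^sub>R x}"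
  using W
proof (induction "dim W" arbitrary: W rule: less_induct)
  case less
  show ?case
  proof (cases "\<forall>A\<in>F. \<exists>l. \<forall>x\<in>W. A x = l *\<^sub>R x")
    case True
    then have "W \<subseteq> {x \<in> W. \<forall>A\<in>F. \<exists>l. A x = l *\<^sub>R x}" by blast
    then show ?thesis using span_superset by blast
  next
    case False
    then obtain A where A: "A \<in> F" "\<And>l. \<exists>x\<in>W. A x \<noteq> l *\<^sub>R x" by blast
    have "W \<noteq> {0}" using A(2)[of 0] linear_0[OF F(1)[OF A(1)]] by auto
    then obtain x0 l where x0: "x0 \<in> W" "x0 \<noteq> 0" "A x0 = l *\<^sub>R x0"
      using symmetric_eigenvector_exists[of A W] F A less.prems by metis
    define W1 where "W1 = {x \<in> W. A x = l *\<^sub>R x}"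
    define W2 where "W2 = {x \<in> W. \<forall>y\<in>W1. B x y = 0}"
    have W1: "subspace W1"
      using less.prems(1) F(1)[OF A(1)]
      by (auto simp: W1_def subspace_def linear_0 linear_add linear_scale scaleR_add_right)
    have W2: "subspace W2"
      using less.prems(1) by (auto simp: W2_def subspace_def B.zero_left B.add_left B.scaleR_left)
    have inv1: "A' x \<in> W1" if "A' \<in> F" "x \<in> W1" for A' x
      using that less.prems(2) F(3)[OF A(1) that(1)] linear_scale[OF F(1)[OF that(1)]] by (simp add: W1_def)
    have inv2: "A' x \<in> W2" if "A' \<in> F" "x \<in> W2" for A' x
      using that less.prems(2) F(2)[OF that(1)] inv1 by (simp add: W2_def)
    have "W1 \<subset> W" using A(2)[of l] by (auto simp: W1_def)
    then have d1: "dim W1 < dim W"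
      using W1 less.prems(1) by (metis dim_subset le_neq_implies_less psubset_imp_subset subspace_dim_equal order_refl psubset_eq)
    have "x0 \<in> W1" using x0 by (simp add: W1_def)
    then have "x0 \<notin> W2" using x0(2) form_eq_0_iff[of x0] by (auto simp: W2_def)
    then have "W2 \<subset> W" using x0(1) by (auto simp: W2_def)
    then have d2: "dim W2 < dim W"
      using W2 less.prems(1) by (metis dim_subset le_neq_implies_less psubset_imp_subset subspace_dim_equal order_refl psubset_eq)
    let ?E = "\<lambda>W. {x \<in> W. \<forall>A\<in>F. \<exists>l. A x = l *\<^sub>R x}"
    have "W1 \<subseteq> span (?E W1)" by (rule less.hyps[OF d1 W1]) (rule inv1)
    moreover have "W2 \<subseteq> span (?E W2)" by (rule less.hyps[OF d2 W2]) (rule inv2)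
    moreover have "span (?E W1) \<subseteq> span (?E W)" "span (?E W2) \<subseteq> span (?E W)"
      by (intro span_mono; auto simp: W1_def W2_def)+
    ultimately have sub: "W1 \<subseteq> span (?E W)" "W2 \<subseteq> span (?E W)" by blast+
    show ?thesis
    proof
      fix x assume x: "x \<in> W"
      obtain y where y: "y \<in> span W1" "\<And>u. u \<in> span W1 \<Longrightarrow> B (x - y) u = 0"
        using form_projection by blast
      have y1: "y \<in> W1" using y(1) W1 by (metis span_eq_iff)
      have "B (x - y) u = 0" if "u \<in> W1" for u using y(2) span_base[OF that] by blast
      moreover have "x - y \<in> W" using x y1 less.prems(1) by (simp add: W1_def subspace_diff)
      ultimately have "x - y \<in> W2" by (simp add: W2_def)
      then have "(x - y) + y \<in> span (?E W)" using y1 sub by (intro span_add) blast+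
      then show "x \<in> span (?E W)" by simp
    qed
  qed
qed

end

section \<open>The group \<open>K\<close>\<close>

locale cartan_decomposition = lie_algebra br
  for br :: "'a::euclidean_space \<Rightarrow> 'a \<Rightarrow> 'a" +
  fixes \<theta> :: "'a \<Rightarrow>\<^sub>L 'a"
  assumes cartan_involution: "cartan_involution br \<theta>"
begin

lemma theta_in_lie_aut: "\<theta> \<in> lie_aut br"
  and theta_compose: "\<theta> o\<^sub>L \<theta> = id_blinfun"
  and B_form_pos: "X \<noteq> 0 \<Longrightarrow> B_form br \<theta> X X > 0"
  using cartan_involution by (auto simp: cartan_involution_def)

lemma theta_theta [simp]: "blinfun_apply \<theta> (blinfun_apply \<theta> X) = X"
  using theta_compose by (rule blinfun_compose_idD)

lemma theta_br: "blinfun_apply \<theta> (br X Y) = br (blinfun_apply \<theta> X) (blinfun_apply \<theta> Y)"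
  by (rule lie_autD(2)[OF theta_in_lie_aut])

lemma killing_theta: "killing br (blinfun_apply \<theta> X) Y = killing br X (blinfun_apply \<theta> Y)"
  using killing_lie_aut[OF theta_in_lie_aut, of X "blinfun_apply \<theta> Y"] by simp

sublocale nondegenerate_lie_algebra
proof
  fix X assume "\<And>Y. killing br X Y = 0"
  then have "B_form br \<theta> X X = 0" by (simp add: B_form_def)
  then show "X = 0" using B_form_pos[of X] by auto
qed

sublocale euclidean_form "B_form br \<theta>"
proof
  show "bilinear (B_form br \<theta>)"
    unfolding bilinear_def B_form_def
    by (auto intro!: linearI simp: linear_add[OF linear_killing_left] linear_scale[OF linear_killing_left]
        linear_add[OF linear_killing_right] linear_scale[OF linear_killing_right] blinfun.bilinear_simps)
  show "B_form br \<theta> X Y = B_form br \<theta> Y X" for X Y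
    by (simp add: B_form_def killing_commute[of X] killing_theta)
qed (rule B_form_pos)

text \<open>Invariance of the Killing form, with \<theta> moved across the bracket. It makes
  \<open>ad Z\<close> skew for \<open>Z\<close> in \<open>cartan_k \<theta>\<close> and symmetric
  for \<open>Z\<close> in \<open>cartan_s \<theta>\<close>.\<close>

lemma B_form_br: "B_form br \<theta> (br Z X) Y = - B_form br \<theta> X (br (blinfun_apply \<theta> Z) Y)"
proof -
  have "killing br (br Z X) (blinfun_apply \<theta> Y) = - killing br (br X Z) (blinfun_apply \<theta> Y)"
    by (subst br_anticommute) (simp add: linear_neg[OF linear_killing_left])
  then show ?thesis by (simp add: B_form_def theta_br killing_invariant)
qed

lemma ad_symmetric:
  assumes "A \<in> cartan_s \<theta>"
  shows "B_form br \<theta> (br A X) Y = B_form br \<theta> X (br A Y)"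
  using assms by (simp add: B_form_br cartan_s_def br.minus_left B.minus_right)

lemma subspace_cartan_k: "subspace (cartan_k \<theta>)"
  and subspace_cartan_s: "subspace (cartan_s \<theta>)"
  by (auto simp: subspace_def cartan_k_def cartan_s_def blinfun.bilinear_simps)

lemma cartan_k_part: "X + blinfun_apply \<theta> X \<in> cartan_k \<theta>"
  and cartan_s_part: "X - blinfun_apply \<theta> X \<in> cartan_s \<theta>"
  by (simp_all add: cartan_k_def cartan_s_def blinfun.bilinear_simps)

lemma theta_exp_ad: "\<theta> o\<^sub>L exp_blinfun (ad br X) = exp_blinfun (ad br (blinfun_apply \<theta> X)) o\<^sub>L \<theta>"
  by (intro exp_blinfun_intertwines lie_aut_ad theta_in_lie_aut)

lemma subgroup_K: "subgroup (K_group br \<theta>) (Aut0 br)"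
  unfolding K_group_def
  by (intro group.generate_is_subgroup group_Aut0) (auto intro: exp_ad_in_Aut0)

lemma K_subset_Aut0: "K_group br \<theta> \<subseteq> carrier (Aut0 br)"
  using subgroup_K by (rule subgroup.subset)

lemma K_subset_lie_aut: "K_group br \<theta> \<subseteq> lie_aut br"
  using K_subset_Aut0 carrier_Aut0_subset by blast

lemma id_in_K: "id_blinfun \<in> K_group br \<theta>"
  using subgroup.one_closed[OF subgroup_K] by (simp add: one_Aut0)

lemma K_compose: "k \<in> K_group br \<theta> \<Longrightarrow> l \<in> K_group br \<theta> \<Longrightarrow> k o\<^sub>L l \<in> K_group br \<theta>"
  using subgroup.m_closed[OF subgroup_K] by (simp add: mult_Aut0)

lemma exp_ad_in_K: "X \<in> cartan_k \<theta> \<Longrightarrow> exp_blinfun (ad br X) \<in> K_group br \<theta>"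
  unfolding K_group_def by (intro generate.incl imageI)

lemma K_inverse:
  assumes "k \<in> K_group br \<theta>"
  obtains l where "l \<in> K_group br \<theta>" "k o\<^sub>L l = id_blinfun" "l o\<^sub>L k = id_blinfun"
  using subgroup.m_inv_closed[OF subgroup_K assms] Aut0_inv K_subset_Aut0 assms by blast

lemma K_theta:
  assumes "k \<in> K_group br \<theta>"
  shows "\<theta> o\<^sub>L k = k o\<^sub>L \<theta>"
  using assms unfolding K_group_def
proof (induction rule: generate.induct)
  case one
  show ?case by (auto intro: blinfun_eqI simp: one_Aut0)
next
  case (incl h)
  then show ?case using theta_exp_ad by (auto simp: cartan_k_def)
next
  case (inv h)
  then obtain X where X: "X \<in> cartan_k \<theta>" "h = exp_blinfun (ad br X)" by blast
  let ?i = "inv\<^bsub>Aut0 br\<^esub> h"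
  have i: "h o\<^sub>L ?i = id_blinfun" "?i o\<^sub>L h = id_blinfun" using Aut0_inv exp_ad_in_Aut0 X by blast+
  have "blinfun_apply \<theta> (blinfun_apply h Y) = blinfun_apply h (blinfun_apply \<theta> Y)" for Y
    using theta_exp_ad[of X] X by (metis (mono_tags) blinfun_apply_blinfun_compose cartan_k_def mem_Collect_eq)
  then show ?case
    by (intro blinfun_eqI) (metis blinfun_apply_blinfun_compose i[THEN blinfun_compose_idD])
next
  case (eng h1 h2)
  show ?case
    using eng.IH[THEN blinfun_compose_commuteD] by (auto intro!: blinfun_eqI simp: mult_Aut0)
qed

text \<open>A group of isometries of \<open>B_form\<close>, hence compact; it serves as the ambient
  group in which K is seen to be closed.\<close>

definition aut_theta :: "('a \<Rightarrow>\<^sub>L 'a) set" where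
  "aut_theta = {g \<in> lie_aut br. \<theta> o\<^sub>L g = g o\<^sub>L \<theta>}"

lemma K_subset_aut_theta: "K_group br \<theta> \<subseteq> aut_theta"
  using K_subset_lie_aut K_theta by (auto simp: aut_theta_def)

lemma aut_theta_apply:
  "g \<in> aut_theta \<Longrightarrow> blinfun_apply \<theta> (blinfun_apply g X) = blinfun_apply g (blinfun_apply \<theta> X)"
  by (simp add: aut_theta_def blinfun_compose_commuteD)

lemma B_form_aut_theta:
  assumes "g \<in> aut_theta"
  shows "B_form br \<theta> (blinfun_apply g X) (blinfun_apply g Y) = B_form br \<theta> X Y"
  using assms aut_theta_apply[OF assms] killing_lie_aut[of g]
  by (simp add: B_form_def aut_theta_def)

text \<open>Factor \<open>g\<close> as \<open>e o\<^sub>L q\<close> with \<open>e\<close> in K and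
  \<open>q\<close> the exponential of an element of \<open>cartan_s \<theta>\<close>. Conjugation by
  \<theta> fixes \<open>g\<close> and \<open>e\<close> but inverts \<open>q\<close>, so
  \<open>q\<close> is its own inverse; being close to the identity, it is the identity.\<close>

lemma aut_theta_near_id_in_K:
  obtains \<delta> where "\<delta> > 0"
    "\<And>g. g \<in> aut_theta \<Longrightarrow> norm (g - id_blinfun) < \<delta> \<Longrightarrow> g \<in> K_group br \<theta>"
proof -
  define \<pi>1 where "\<pi>1 X = (1/2) *\<^sub>R (X + blinfun_apply \<theta> X)" for X
  define \<pi>2 where "\<pi>2 X = (1/2) *\<^sub>R (X - blinfun_apply \<theta> X)" for X
  have \<pi>: "linear \<pi>1" "linear \<pi>2" "\<And>X. \<pi>1 X + \<pi>2 X = X"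
    by (auto intro!: linearI simp: \<pi>1_def \<pi>2_def blinfun.bilinear_simps algebra_simps)
      (simp flip: scaleR_2)
  have \<pi>_in: "\<pi>1 X \<in> cartan_k \<theta>" "\<pi>2 X \<in> cartan_s \<theta>" for X
    unfolding \<pi>1_def \<pi>2_def
    by (intro subspace_scale subspace_cartan_k subspace_cartan_s cartan_k_part cartan_s_part)+
  have "bounded_linear (\<lambda>X. ad br (2 *\<^sub>R \<pi>2 X))"
    using \<pi>(2) by (intro bounded_linear_compose[OF bounded_linear_ad] bounded_linear_const_scaleR)
      (simp add: linear_conv_bounded_linear)
  then obtain M where M: "M \<ge> 1" "\<And>X. norm (ad br (2 *\<^sub>R \<pi>2 X)) \<le> M * norm X"
    by (rule bounded_linear_bound_ge_1) blast
  \<comment> \<open>With this radius \<open>u = ad br (2 *\<^sub>R \<pi>2 X)\<close> has norm at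
    most 1/2. If \<open>exp u\<close> is the identity, the second-order estimate gives
    \<open>norm u \<le> (norm u)\<^sup>2\<close>, so \<open>u = 0\<close>.\<close>
  have "1 / (2 * M) > 0" using M by simp
  from lie_aut_local_factorization[OF \<pi> this] obtain \<delta> where \<delta>: "\<delta> > 0"
    "\<And>g. g \<in> lie_aut br \<Longrightarrow> norm (g - id_blinfun) < \<delta> \<Longrightarrow>
      \<exists>X. norm X \<le> 1 / (2 * M) \<and> g = exp_blinfun (ad br (\<pi>1 X)) o\<^sub>L exp_blinfun (ad br (\<pi>2 X))"
    by metis
  show ?thesis
  proof (rule that[OF \<delta>(1)])
    fix g assume g: "g \<in> aut_theta" "norm (g - id_blinfun) < \<delta>"
    then obtain X where X: "norm X \<le> 1 / (2 * M)"
      and g_eq: "g = exp_blinfun (ad br (\<pi>1 X)) o\<^sub>L exp_blinfun (ad br (\<pi>2 X))"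
      using \<delta>(2) by (auto simp: aut_theta_def)
    define e q where "e = exp_blinfun (ad br (\<pi>1 X))" and "q = exp_blinfun (ad br (\<pi>2 X))"
    have eK: "e \<in> K_group br \<theta>" unfolding e_def by (intro exp_ad_in_K \<pi>_in)
    then obtain e' where e': "e' o\<^sub>L e = id_blinfun" using K_inverse by blast
    have \<theta>q: "\<theta> o\<^sub>L q = exp_blinfun (- ad br (\<pi>2 X)) o\<^sub>L \<theta>"
      using theta_exp_ad[of "\<pi>2 X"] \<pi>_in(2)[of X] by (simp add: q_def cartan_s_def ad_simps)
    have "exp_blinfun (- ad br (\<pi>2 X)) = q"
    proof (rule blinfun_eqI)
      fix Y
      have "blinfun_apply e (blinfun_apply \<theta> (blinfun_apply q (blinfun_apply \<theta> Y)))
          = blinfun_apply e (blinfun_apply q Y)"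
        using aut_theta_apply[OF g(1), of "blinfun_apply \<theta> Y"] aut_theta_apply[of e] eK K_subset_aut_theta
        by (auto simp: g_eq e_def q_def)
      then have "blinfun_apply \<theta> (blinfun_apply q (blinfun_apply \<theta> Y)) = blinfun_apply q Y"
        by (metis e' blinfun_compose_idD)
      moreover have "blinfun_apply \<theta> (blinfun_apply q (blinfun_apply \<theta> Y))
          = blinfun_apply (exp_blinfun (- ad br (\<pi>2 X))) Y"
        using arg_cong[OF \<theta>q, of "\<lambda>f. blinfun_apply f (blinfun_apply \<theta> Y)"] by simp
      ultimately show "blinfun_apply (exp_blinfun (- ad br (\<pi>2 X))) Y = blinfun_apply q Y" by simp
    qed
    then have "exp_blinfun (ad br (2 *\<^sub>R \<pi>2 X)) = id_blinfun"
      using exp_blinfun_minus(2)[of "ad br (\<pi>2 X)"] by (simp add: ad_simps exp_blinfun_double q_def)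
    moreover have small: "norm (ad br (2 *\<^sub>R \<pi>2 X)) \<le> 1 / 2"
    proof -
      have "M * norm X \<le> M * (1 / (2 * M))" using X M by (intro mult_left_mono) auto
      then show ?thesis using M(2)[of X] M(1) by simp
    qed
    ultimately have "norm (ad br (2 *\<^sub>R \<pi>2 X)) \<le> (norm (ad br (2 *\<^sub>R \<pi>2 X)))\<^sup>2"
      using norm_exp_blinfun_minus_id_minus_le[of "ad br (2 *\<^sub>R \<pi>2 X)"] by simp
    also have "\<dots> \<le> 1 / 2 * norm (ad br (2 *\<^sub>R \<pi>2 X))"
      unfolding power2_eq_square using small by (intro mult_right_mono) auto
    finally have "ad br (2 *\<^sub>R \<pi>2 X) = 0" by (simp add: norm_le_zero_iff[symmetric] del: norm_le_zero_iff)
    then have "q = id_blinfun" by (simp add: q_def ad_simps exp_blinfun_0)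
    then have "g = e" by (auto intro: blinfun_eqI simp: g_eq e_def[symmetric] q_def[symmetric])
    then show "g \<in> K_group br \<theta>" using eK by simp
  qed
qed

lemma aut_theta_inverse:
  assumes "g \<in> aut_theta"
  obtains h where "h \<in> aut_theta" "g o\<^sub>L h = id_blinfun" "h o\<^sub>L g = id_blinfun"
proof -
  obtain h where h: "h \<in> lie_aut br" "g o\<^sub>L h = id_blinfun" "h o\<^sub>L g = id_blinfun"
    using assms lie_aut_inverse by (auto simp: aut_theta_def)
  have "\<theta> o\<^sub>L h = h o\<^sub>L \<theta>"
    by (rule blinfun_eqI)
      (metis aut_theta_apply[OF assms] blinfun_apply_blinfun_compose h(2,3)[THEN blinfun_compose_idD])
  with h show ?thesis using that by (simp add: aut_theta_def)
qed

text \<open>The equations pass to the limit, but invertibility is not a closed condition. It is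
  recovered from the invariance of \<open>B_form\<close>, which makes the limit injective.\<close>

lemma closed_aut_theta: "closed aut_theta"
  unfolding closed_sequential_limits
proof (intro allI impI, elim conjE)
  fix g l assume g: "\<forall>n. g n \<in> aut_theta" and lim: "g \<longlonglongrightarrow> l"
  have l: "(\<lambda>n. blinfun_apply (g n) X) \<longlonglongrightarrow> blinfun_apply l X" for X
    by (intro tendsto_intros lim)
  have br: "blinfun_apply l (br X Y) = br (blinfun_apply l X) (blinfun_apply l Y)" for X Y
    using LIMSEQ_unique[OF l[of "br X Y"]] br.tendsto[OF l l, of X Y] g
    by (simp add: aut_theta_def lie_autD)
  have th: "blinfun_apply \<theta> (blinfun_apply l X) = blinfun_apply l (blinfun_apply \<theta> X)" for X
    using LIMSEQ_unique[OF l[of "blinfun_apply \<theta> X"]] blinfun.tendsto[OF tendsto_const[of \<theta>] l[of X]] g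
    by (simp add: aut_theta_apply)
  have "B_form br \<theta> (blinfun_apply l X) (blinfun_apply l X) = B_form br \<theta> X X" for X
    using B.tendsto[OF l[of X] l[of X]] g by (simp add: B_form_aut_theta LIMSEQ_const_iff)
  then have "inj (blinfun_apply l)"
    unfolding linear_injective_0[OF bounded_linear.linear[OF blinfun.bounded_linear_right]]
    using form_eq_0_iff B.zero_left by metis
  then have "bij (blinfun_apply l)"
    using linear_injective_imp_surjective bounded_linear.linear[OF blinfun.bounded_linear_right]
    by (auto simp: bij_def)
  then show "l \<in> aut_theta"
    using br th by (auto simp: aut_theta_def lie_aut_def intro: blinfun_eqI)
qed

lemma bounded_aut_theta: "bounded aut_theta"
proof -
  obtain c where c: "c > 0" "\<And>X. c * (norm X)\<^sup>2 \<le> B_form br \<theta> X X" using form_lower_bound by blast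
  obtain C where C: "C > 0" "\<And>X Y. norm (B_form br \<theta> X Y) \<le> norm X * norm Y * C"
    using B.pos_bounded by blast
  have "norm g \<le> sqrt (C / c)" if g: "g \<in> aut_theta" for g
  proof (rule norm_blinfun_bound)
    fix X
    have "c * (norm (blinfun_apply g X))\<^sup>2 \<le> B_form br \<theta> X X"
      using c(2)[of "blinfun_apply g X"] B_form_aut_theta[OF g, of X X] by simp
    also have "\<dots> \<le> C * (norm X)\<^sup>2" using C(2)[of X X] by (simp add: power2_eq_square mult.commute)
    finally have "(norm (blinfun_apply g X))\<^sup>2 \<le> (C / c) * (norm X)\<^sup>2"
      using c(1) by (simp add: field_simps)
    then have "sqrt ((norm (blinfun_apply g X))\<^sup>2) \<le> sqrt ((C / c) * (norm X)\<^sup>2)"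
      by (rule real_sqrt_le_mono)
    then show "norm (blinfun_apply g X) \<le> sqrt (C / c) * norm X"
      by (simp add: real_sqrt_mult real_sqrt_divide)
  qed (use c C in auto)
  then show ?thesis by (auto simp: bounded_iff)
qed

text \<open>K contains a neighbourhood of the identity in \<open>aut_theta\<close>, so it is an open
  subgroup, and open subgroups are closed: if \<open>k n\<close> tends to \<open>g\<close>, then
  \<open>k n\<close> eventually differs from \<open>g\<close> by an element of K.\<close>

lemma compact_K: "compact (K_group br \<theta>)"
proof -
  obtain \<delta> where \<delta>: "\<delta> > 0"
    "\<And>g. g \<in> aut_theta \<Longrightarrow> norm (g - id_blinfun) < \<delta> \<Longrightarrow> g \<in> K_group br \<theta>"
    using aut_theta_near_id_in_K by blast
  have "closed (K_group br \<theta>)"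
    unfolding closed_sequential_limits
  proof (intro allI impI, elim conjE)
    fix k g assume k: "\<forall>n. k n \<in> K_group br \<theta>" and lim: "k \<longlonglongrightarrow> g"
    have "g \<in> aut_theta"
      using closed_aut_theta k K_subset_aut_theta lim unfolding closed_sequential_limits by blast
    then obtain h where h: "h \<in> aut_theta" "g o\<^sub>L h = id_blinfun" "h o\<^sub>L g = id_blinfun"
      using aut_theta_inverse by blast
    have "(\<lambda>n. h o\<^sub>L k n) \<longlonglongrightarrow> (h o\<^sub>L g)" by (intro tendsto_intros lim)
    then have "\<exists>N. \<forall>n\<ge>N. norm ((h o\<^sub>L k n) - (h o\<^sub>L g)) < \<delta>" using \<delta>(1) by (rule LIMSEQ_D)
    then obtain n where n: "norm ((h o\<^sub>L k n) - id_blinfun) < \<delta>" unfolding h(3) by blast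
    have "h o\<^sub>L k n \<in> aut_theta"
      using h(1) k K_subset_aut_theta aut_theta_apply
      by (auto simp: aut_theta_def lie_aut_compose subset_iff intro!: blinfun_eqI)
    then have hk: "h o\<^sub>L k n \<in> K_group br \<theta>" using \<delta>(2) n by blast
    obtain k' where k': "k' \<in> K_group br \<theta>" "k' o\<^sub>L (h o\<^sub>L k n) = id_blinfun"
      "(h o\<^sub>L k n) o\<^sub>L k' = id_blinfun"
      using K_inverse[OF hk] by blast
    have "k n o\<^sub>L k' = g"
    proof (rule blinfun_eqI)
      fix X
      have "blinfun_apply h (blinfun_apply (k n) (blinfun_apply k' X)) = X"
        using k'(3)[THEN blinfun_compose_idD, of X] by simp
      then show "blinfun_apply (k n o\<^sub>L k') X = blinfun_apply g X"
        using h(2)[THEN blinfun_compose_idD] by (metis blinfun_apply_blinfun_compose)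
    qed
    then show "g \<in> K_group br \<theta>" using K_compose k k'(1) by metis
  qed
  moreover have "bounded (K_group br \<theta>)"
    using bounded_aut_theta K_subset_aut_theta bounded_subset by blast
  ultimately show ?thesis by (simp add: compact_eq_bounded_closed)
qed

end

section \<open>The adjoint orbit\<close>

text \<open>The sum need not be direct: \<open>cartan_k \<theta>\<close> and
  \<open>eigensum {0..}\<close> share the centralizer of \<open>H\<close> in
  \<open>cartan_k \<theta>\<close>. Choosing components of the basis vectors still gives a linear
  map.\<close>

lemma linear_splitting:
  fixes U V :: "'a::euclidean_space set"
  assumes U: "subspace U" and V: "subspace V" and UV: "\<And>x. \<exists>u\<in>U. x - u \<in> V"
  obtains f where "linear f" "\<And>x. f x \<in> U" "\<And>x. x - f x \<in> V"
proof -
  obtain u where u: "\<And>x. u x \<in> U" "\<And>x. x - u x \<in> V" using UV by metis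
  define f where "f x = (\<Sum>b\<in>Basis. (x \<bullet> b) *\<^sub>R u b)" for x
  have "linear f"
    by (rule linearI) (simp_all add: f_def inner_add_left scaleR_add_left sum.distrib scaleR_sum_right)
  moreover have "f x \<in> U" for x
    unfolding f_def using u(1) by (intro subspace_sum U subspace_scale) auto
  moreover have "x - f x \<in> V" for x
  proof -
    have "x - f x = (\<Sum>b\<in>Basis. (x \<bullet> b) *\<^sub>R b) - f x" by (simp add: euclidean_representation)
    also have "\<dots> = (\<Sum>b\<in>Basis. (x \<bullet> b) *\<^sub>R (b - u b))"
      by (simp add: f_def sum_subtractf scaleR_diff_right)
    finally show ?thesis using u(2) by (simp add: subspace_sum V subspace_scale)
  qed
  ultimately show ?thesis by (rule that)
qed

locale cartan_element = cartan_decomposition br \<theta>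
  for br :: "'a::euclidean_space \<Rightarrow> 'a \<Rightarrow> 'a" and \<theta> :: "'a \<Rightarrow>\<^sub>L 'a" +
  fixes H :: 'a
  assumes H_in_s: "H \<in> cartan_s \<theta>"
begin

section \<open>The grading by the eigenvalues of ad H\<close>

definition eigenspace :: "real \<Rightarrow> 'a set" where
  "eigenspace l = {X. br H X = l *\<^sub>R X}"

text \<open>Arbitrary index sets let the positive, the non-negative and the truncated sums share one
  calculus; reals that are not eigenvalues contribute nothing.\<close>

definition eigensum :: "real set \<Rightarrow> 'a set" where
  "eigensum A = span (\<Union>l\<in>A. eigenspace l)"

lemma theta_H: "blinfun_apply \<theta> H = - H"
  using H_in_s by (simp add: cartan_s_def)

lemma subspace_eigensum: "subspace (eigensum A)"
  by (simp add: eigensum_def)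

lemma eigenspace_subset_eigensum: "l \<in> A \<Longrightarrow> X \<in> eigenspace l \<Longrightarrow> X \<in> eigensum A"
  unfolding eigensum_def by (intro span_base) auto

lemma eigensum_mono: "A \<subseteq> A' \<Longrightarrow> eigensum A \<subseteq> eigensum A'"
  unfolding eigensum_def by (intro span_mono UN_mono) auto

lemma eigensum_induct [consumes 1, case_names eigenvector subspace]:
  assumes "X \<in> eigensum A"
    and "\<And>l X. l \<in> A \<Longrightarrow> X \<in> eigenspace l \<Longrightarrow> X \<in> V"
    and "subspace V"
  shows "X \<in> V"
  using assms(1) unfolding eigensum_def
  by (rule span_induct[of X _ "\<lambda>X. X \<in> V", simplified]) (use assms(2,3) in auto)

lemma br_eigenspace: "X \<in> eigenspace l \<Longrightarrow> Y \<in> eigenspace m \<Longrightarrow> br X Y \<in> eigenspace (l + m)"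
  by (simp add: eigenspace_def br_derivation[of H] br.scaleR_left br.scaleR_right scaleR_add_left)

lemma br_eigensum:
  assumes "X \<in> eigensum A" "Y \<in> eigensum A'" and AA': "\<And>l m. l \<in> A \<Longrightarrow> m \<in> A' \<Longrightarrow> l + m \<in> C"
  shows "br X Y \<in> eigensum C"
proof -
  have "X \<in> {X. br X Y \<in> eigensum C}"
    using assms(1)
  proof (induction rule: eigensum_induct)
    case (eigenvector l X)
    have "Y \<in> {Y. br X Y \<in> eigensum C}"
      using assms(2)
    proof (induction rule: eigensum_induct)
      case (eigenvector m Y)
      then show ?case
        using AA' \<open>l \<in> A\<close> br_eigenspace[OF \<open>X \<in> eigenspace l\<close>] eigenspace_subset_eigensum by blast
    qed (intro linear_subspace_linear_preimage subspace_eigensum bounded_linear.linear br.bounded_linear_right)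
    then show ?case by simp
  qed (intro linear_subspace_linear_preimage subspace_eigensum bounded_linear.linear br.bounded_linear_left)
  then show ?thesis by simp
qed

text \<open>\<open>ad H\<close> is symmetric for \<open>B_form\<close>, so joint diagonalization
  applies to it alone.\<close>

lemma eigensum_UNIV: "eigensum UNIV = UNIV"
proof -
  have "UNIV \<subseteq> span {x \<in> UNIV. \<forall>A\<in>{br H}. \<exists>l. A x = l *\<^sub>R x}"
    by (rule commuting_symmetric_joint_eigenvectors)
      (auto simp: ad_symmetric H_in_s intro: bounded_linear.linear br.bounded_linear_right)
  then show ?thesis
    by (auto simp: eigensum_def eigenspace_def Collect_ex_eq[symmetric])
qed

text \<open>Eigenvalues are bounded by the operator norm; this ends the elimination once the degree
  is large enough.\<close>

lemma eigensum_atLeast_large: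
  assumes "t > norm (ad br H)"
  shows "eigensum {t..} = {0}"
proof -
  have zero: "X = 0" if "l \<ge> t" "X \<in> eigenspace l" for l X
  proof -
    have "0 \<le> l" using that(1) assms norm_ge_zero[of "ad br H"] by linarith
    then have "l * norm X \<le> norm (ad br H) * norm X"
      using norm_blinfun[of "ad br H" X] that
      by (simp add: eigenspace_def)
    then show ?thesis using that assms by (auto simp: mult_le_cancel_right)
  qed
  have "X \<in> {0}" if "X \<in> eigensum {t..}" for X
    using that by (induction rule: eigensum_induct) (use zero in \<open>auto simp: subspace_def\<close>)
  then show ?thesis using subspace_0[OF subspace_eigensum] by blast
qed

text \<open>Only finitely many eigenvectors enter \<open>z\<close>, so their eigenvalues have a
  positive lower bound. Doubling has to start from such a bound.\<close>

lemma eigensum_pos_gap: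
  assumes "z \<in> eigensum {0<..}"
  obtains t where "t > 0" "z \<in> eigensum {t..}"
proof -
  have mono: "eigensum {t..} \<subseteq> eigensum {s..}" if "s \<le> t" for s t
    using that by (intro eigensum_mono) auto
  have "z \<in> {z. \<exists>t>0. z \<in> eigensum {t..}}"
    using assms
  proof (induction rule: eigensum_induct)
    case (eigenvector l X)
    then show ?case using eigenspace_subset_eigensum[of l "{l..}"] by auto
  next
    case subspace
    show ?case
    proof (rule subspaceI)
      show "0 \<in> {z. \<exists>t>0. z \<in> eigensum {t..}}"
        using subspace_0[OF subspace_eigensum] by (auto intro: exI[of _ 1])
    next
      fix x y assume "x \<in> {z. \<exists>t>0. z \<in> eigensum {t..}}" "y \<in> {z. \<exists>t>0. z \<in> eigensum {t..}}"
      then obtain s t where "s > 0" "t > 0" "x \<in> eigensum {s..}" "y \<in> eigensum {t..}" by blast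
      then have "x + y \<in> eigensum {min s t..}"
        using mono[of "min s t" s] mono[of "min s t" t] by (auto intro!: subspace_add subspace_eigensum)
      then show "x + y \<in> {z. \<exists>t>0. z \<in> eigensum {t..}}"
        using \<open>s > 0\<close> \<open>t > 0\<close> by (auto intro!: exI[of _ "min s t"])
    next
      fix c x assume "x \<in> {z. \<exists>t>0. z \<in> eigensum {t..}}"
      then show "c *\<^sub>R x \<in> {z. \<exists>t>0. z \<in> eigensum {t..}}"
        using subspace_scale[OF subspace_eigensum] by blast
    qed
  qed
  then show ?thesis using that by blast
qed

lemma ad_H_preimage:
  assumes "z \<in> eigensum A" "\<And>l. l \<in> A \<Longrightarrow> l > 0"
  obtains X where "X \<in> eigensum A" "br H X = z"
proof -
  have "z \<in> br H ` eigensum A"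
    using assms(1)
  proof (induction rule: eigensum_induct)
    case (eigenvector l X)
    then have "br H ((1 / l) *\<^sub>R X) = X" using assms(2)[of l] by (simp add: eigenspace_def br.scaleR_right)
    moreover have "(1 / l) *\<^sub>R X \<in> eigensum A"
      using eigenvector eigenspace_subset_eigensum subspace_scale[OF subspace_eigensum] by blast
    ultimately show ?case by (metis image_eqI)
  next
    case subspace
    show ?case
      by (intro linear_subspace_image subspace_eigensum bounded_linear.linear br.bounded_linear_right)
  qed
  then show ?thesis using that by blast
qed

abbreviation "n_pos \<equiv> eigensum {0<..}"

text \<open>\<open>exp (ad X)\<close> with \<open>[H, X] = z\<close> cancels \<open>z\<close> in \<open>H + z\<close> up to terms of twice the degree.\<close>

lemma exp_ad_eliminates:
  assumes "t > 0" "z \<in> eigensum {t..}"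
  obtains X z' where "z' \<in> eigensum {2 * t..}" "blinfun_apply (exp_blinfun (ad br X)) (H + z) = H + z'"
proof -
  obtain X where X: "X \<in> eigensum {t..}" "br H X = z"
    using ad_H_preimage[OF assms(2)] assms(1) by (metis atLeast_iff less_le_trans)
  have brX: "br X Y \<in> eigensum {2 * t..}" if "Y \<in> eigensum {t..}" for Y
    using X(1) that by (rule br_eigensum) auto
  have sub: "Y \<in> eigensum {t..}" if "Y \<in> eigensum {2 * t..}" for Y
    using that eigensum_mono[of "{2 * t..}" "{t..}"] assms(1) by auto
  have XH: "br X H = - z" using X(2) br_anticommute[of X H] by simp
  \<comment> \<open>The first-order term \<open>[X, H] = - z\<close> is what cancels
    \<open>z\<close>; \<open>[X, [X, H]]\<close> and \<open>[X, z]\<close> already have degree at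
    least \<open>2 * t\<close>.\<close>
  have "blinfun_apply (exp_blinfun (ad br X)) H - H - blinfun_apply (ad br X) H \<in> eigensum {2 * t..}"
    using brX sub XH assms(2) subspace_eigensum
    by (intro exp_blinfun_apply_diff_in_subspace') (auto simp: br.minus_right subspace_neg)
  moreover have "blinfun_apply (exp_blinfun (ad br X)) z - z \<in> eigensum {2 * t..}"
    using brX sub assms(2) subspace_eigensum
    by (intro exp_blinfun_apply_diff_in_subspace) auto
  ultimately have "(blinfun_apply (exp_blinfun (ad br X)) H - H - blinfun_apply (ad br X) H)
      + (blinfun_apply (exp_blinfun (ad br X)) z - z) \<in> eigensum {2 * t..}"
    by (rule subspace_add[OF subspace_eigensum])
  then have "blinfun_apply (exp_blinfun (ad br X)) (H + z) - H \<in> eigensum {2 * t..}"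
    by (simp add: XH blinfun.add_right algebra_simps)
  then show ?thesis using that[of "blinfun_apply (exp_blinfun (ad br X)) (H + z) - H" X] by simp
qed

text \<open>Each elimination doubles the lower bound \<open>t\<close> for the degrees in
  \<open>z\<close>. After \<open>n\<close> of them it exceeds \<open>norm (ad br H)\<close>, and
  nothing is left.\<close>

lemma n_pos_translate_to_H:
  assumes "z \<in> n_pos"
  obtains g where "g \<in> carrier (Aut0 br)" "blinfun_apply g (H + z) = H"
proof -
  obtain t where t: "t > 0" "z \<in> eigensum {t..}" using eigensum_pos_gap[OF assms] by blast
  obtain n where n: "norm (ad br H) / t < 2 ^ n"
    using real_arch_pow[of 2 "norm (ad br H) / t"] by auto
  have "\<exists>g\<in>carrier (Aut0 br). blinfun_apply g (H + z) = H"
    using t n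
  proof (induction n arbitrary: t z)
    case 0
    then have "z = 0" using eigensum_atLeast_large[of t] by (simp add: field_simps)
    then show ?case using monoid.one_closed[OF group.is_monoid[OF group_Aut0]]
      by (force simp: one_Aut0)
  next
    case (Suc n)
    obtain X z' where X: "z' \<in> eigensum {2 * t..}" "blinfun_apply (exp_blinfun (ad br X)) (H + z) = H + z'"
      using exp_ad_eliminates Suc.prems by blast
    have "norm (ad br H) / (2 * t) < 2 ^ n" using Suc.prems by (simp add: field_simps)
    with Suc.IH[of "2 * t" z'] X Suc.prems obtain g where g: "g \<in> carrier (Aut0 br)" "blinfun_apply g (H + z') = H"
      by auto
    have "g o\<^sub>L exp_blinfun (ad br X) \<in> carrier (Aut0 br)"
      using monoid.m_closed[OF group.is_monoid[OF group_Aut0] g(1) exp_ad_in_Aut0] by (simp add: mult_Aut0)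
    moreover have "blinfun_apply (g o\<^sub>L exp_blinfun (ad br X)) (H + z) = H" using X g by simp
    ultimately show ?case by blast
  qed
  then show ?thesis using that by blast
qed

text \<open>On automorphisms it plays the part of the parabolic subgroup with Lie algebra
  \<open>eigensum {0..}\<close>. Admitting all operators makes it visibly closed, and closure under
  composition suffices.\<close>

definition stabilizer_n :: "('a \<Rightarrow>\<^sub>L 'a) set" where
  "stabilizer_n = {g. \<forall>z\<in>n_pos. blinfun_apply g (H + z) - H \<in> n_pos}"

lemma closed_stabilizer_n: "closed stabilizer_n"
proof -
  have "closed {g. blinfun_apply g (H + z) - H \<in> n_pos}" for z
    using closed_vimage[OF closed_subspace[OF subspace_eigensum], of "\<lambda>g. blinfun_apply g (H + z) - H"]
    by (simp add: vimage_def continuous_intros)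
  moreover have "stabilizer_n = (\<Inter>z\<in>n_pos. {g. blinfun_apply g (H + z) - H \<in> n_pos})"
    by (auto simp: stabilizer_n_def)
  ultimately show ?thesis by (simp add: closed_INT)
qed

lemma stabilizer_n_compose:
  assumes "g \<in> stabilizer_n" "h \<in> stabilizer_n"
  shows "g o\<^sub>L h \<in> stabilizer_n"
  unfolding stabilizer_n_def
proof (intro CollectI ballI)
  fix z assume "z \<in> n_pos"
  then have "blinfun_apply h (H + z) - H \<in> n_pos" using assms(2) by (simp add: stabilizer_n_def)
  then have "blinfun_apply g (H + (blinfun_apply h (H + z) - H)) - H \<in> n_pos"
    using assms(1) unfolding stabilizer_n_def by blast
  then show "blinfun_apply (g o\<^sub>L h) (H + z) - H \<in> n_pos" by simp
qed

text \<open>Bracketing with \<open>H\<close> annihilates the part of degree zero, so only positive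
  degrees survive.\<close>

lemma br_H_nonneg: "X \<in> eigensum {0..} \<Longrightarrow> br X H \<in> n_pos"
proof -
  assume "X \<in> eigensum {0..}"
  then have "X \<in> {X. br X H \<in> n_pos}"
  proof (induction rule: eigensum_induct)
    case (eigenvector l X)
    then have XH: "br X H = - l *\<^sub>R X" using br_anticommute[of X H] by (simp add: eigenspace_def)
    show ?case
    proof (cases "l = 0")
      case False
      then have "X \<in> n_pos" using eigenvector eigenspace_subset_eigensum[of l "{0<..}"] by auto
      then show ?thesis using XH subspace_scale[OF subspace_eigensum] by (metis mem_Collect_eq)
    qed (use XH subspace_0[OF subspace_eigensum] in auto)
  qed (intro linear_subspace_linear_preimage subspace_eigensum bounded_linear.linear br.bounded_linear_left)
  then show ?thesis by simp
qed

lemma exp_ad_in_stabilizer_n: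
  assumes X: "X \<in> eigensum {0..}"
  shows "exp_blinfun (ad br X) \<in> stabilizer_n"
  unfolding stabilizer_n_def
proof (intro CollectI ballI)
  fix z assume z: "z \<in> n_pos"
  have brX: "br X Y \<in> n_pos" if "Y \<in> n_pos" for Y
    using X that by (rule br_eigensum) auto
  have "blinfun_apply (exp_blinfun (ad br X)) (H + z) - (H + z) \<in> n_pos"
    using brX z br_H_nonneg[OF X] subspace_eigensum
    by (intro exp_blinfun_apply_diff_in_subspace) (auto simp: br.add_right subspace_add)
  then have "(blinfun_apply (exp_blinfun (ad br X)) (H + z) - (H + z)) + z \<in> n_pos"
    using z by (rule subspace_add[OF subspace_eigensum])
  then show "blinfun_apply (exp_blinfun (ad br X)) (H + z) - H \<in> n_pos" by simp
qed

lemma theta_eigenspace: "X \<in> eigenspace l \<Longrightarrow> blinfun_apply \<theta> X \<in> eigenspace (- l)"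
  using theta_br[of H X] by (simp add: eigenspace_def theta_H br.minus_left blinfun.scaleR_right minus_equation_iff)

text \<open>An eigenvector \<open>X\<close> for a negative eigenvalue is
  \<open>(X + \<theta> X) - \<theta> X\<close>, and \<theta> reverses the sign of eigenvalues. This
  is a coarse infinitesimal Iwasawa decomposition.\<close>

lemma k_plus_nonneg: "\<exists>u\<in>cartan_k \<theta>. X - u \<in> eigensum {0..}"
proof -
  have "X \<in> eigensum UNIV" by (simp add: eigensum_UNIV)
  then have "X \<in> {X. \<exists>u\<in>cartan_k \<theta>. X - u \<in> eigensum {0..}}"
  proof (induction rule: eigensum_induct)
    case (eigenvector l X)
    show ?case
    proof (cases "l \<ge> 0")
      case True
      then show ?thesis using eigenvector eigenspace_subset_eigensum subspace_0[OF subspace_cartan_k]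
        by (auto intro!: bexI[of _ 0])
    next
      case False
      then have "blinfun_apply \<theta> X \<in> eigensum {0..}"
        using theta_eigenspace[OF eigenvector(2)] eigenspace_subset_eigensum[of "- l" "{0..}"] by auto
      then have "X - (X + blinfun_apply \<theta> X) \<in> eigensum {0..}"
        using subspace_neg[OF subspace_eigensum] by simp
      then show ?thesis using cartan_k_part by blast
    qed
  next
    case subspace
    show ?case
    proof (rule subspaceI)
      show "0 \<in> {X. \<exists>u\<in>cartan_k \<theta>. X - u \<in> eigensum {0..}}"
        using subspace_0[OF subspace_cartan_k] subspace_0[OF subspace_eigensum] by force
    next
      fix x y assume "x \<in> {X. \<exists>u\<in>cartan_k \<theta>. X - u \<in> eigensum {0..}}"
        "y \<in> {X. \<exists>u\<in>cartan_k \<theta>. X - u \<in> eigensum {0..}}"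
      then obtain u v where "u \<in> cartan_k \<theta>" "v \<in> cartan_k \<theta>" "x - u \<in> eigensum {0..}" "y - v \<in> eigensum {0..}"
        by blast
      then have "u + v \<in> cartan_k \<theta>" "(x - u) + (y - v) \<in> eigensum {0..}"
        using subspace_add[OF subspace_cartan_k] subspace_add[OF subspace_eigensum] by blast+
      then show "x + y \<in> {X. \<exists>u\<in>cartan_k \<theta>. X - u \<in> eigensum {0..}}"
        by (auto simp: algebra_simps intro!: bexI[of _ "u + v"])
    next
      fix c x assume "x \<in> {X. \<exists>u\<in>cartan_k \<theta>. X - u \<in> eigensum {0..}}"
      then obtain u where "u \<in> cartan_k \<theta>" "x - u \<in> eigensum {0..}" by blast
      then have "c *\<^sub>R u \<in> cartan_k \<theta>" "c *\<^sub>R x - c *\<^sub>R u \<in> eigensum {0..}"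
        using subspace_scale[OF subspace_cartan_k] subspace_scale[OF subspace_eigensum]
        by (auto simp flip: scaleR_diff_right)
      then show "c *\<^sub>R x \<in> {X. \<exists>u\<in>cartan_k \<theta>. X - u \<in> eigensum {0..}}" by blast
    qed
  qed
  then show ?thesis by simp
qed

text \<open>The set of all \<open>g\<close> with \<open>k g \<in> stabilizer_n\<close> for some \<open>k \<in> K\<close> is closed because \<open>K\<close> is compact, and
  open because \<open>cartan_k \<theta>\<close> and the non-negative eigenspaces of \<open>ad H\<close> span the Lie algebra.\<close>

lemma Aut0_factorization:
  assumes "g \<in> carrier (Aut0 br)"
  obtains k where "k \<in> K_group br \<theta>" "k o\<^sub>L g \<in> stabilizer_n"
proof -
  define R where "R = {g. \<exists>k\<in>K_group br \<theta>. k o\<^sub>L g \<in> stabilizer_n}"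
  have "closed R"
    unfolding closed_sequential_limits
  proof (intro allI impI, elim conjE)
    fix g l assume g: "\<forall>n. g n \<in> R" and lim: "g \<longlonglongrightarrow> l"
    then obtain k where k: "\<And>n. k n \<in> K_group br \<theta>" "\<And>n. k n o\<^sub>L g n \<in> stabilizer_n"
      unfolding R_def by (simp add: Bex_def) metis
    obtain k0 s where k0: "k0 \<in> K_group br \<theta>" "strict_mono s" "(k \<circ> s) \<longlonglongrightarrow> k0"
      using compact_K k(1) unfolding compact_def by metis
    have "(\<lambda>n. k (s n) o\<^sub>L g (s n)) \<longlonglongrightarrow> (k0 o\<^sub>L l)"
      using k0(3) LIMSEQ_subseq_LIMSEQ[OF lim k0(2)] by (intro tendsto_intros) (auto simp: comp_def)
    then have "k0 o\<^sub>L l \<in> stabilizer_n"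
      using closed_stabilizer_n k(2) unfolding closed_sequential_limits by fast
    then show "l \<in> R" using k0(1) by (auto simp: R_def)
  qed
  then have cl: "closedin (top_of_set (carrier (Aut0 br))) (carrier (Aut0 br) \<inter> R)"
    by (rule closedin_closed_Int)
  obtain \<pi> where \<pi>: "linear \<pi>" "\<And>X. \<pi> X \<in> cartan_k \<theta>" "\<And>X. X - \<pi> X \<in> eigensum {0..}"
    using linear_splitting[OF subspace_cartan_k subspace_eigensum k_plus_nonneg] by blast
  have "linear (\<lambda>X. X - \<pi> X)" using \<pi>(1) by (intro linear_compose_sub) (auto simp: linear_ident)
  moreover have "\<pi> X + (X - \<pi> X) = X" for X by simp
  \<comment> \<open>Only the factorisation is used below; the bound 1 on \<open>norm X\<close> is an
    arbitrary choice.\<close>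
  ultimately obtain \<delta> where \<delta>: "\<delta> > 0" "\<And>g. g \<in> lie_aut br \<Longrightarrow> norm (g - id_blinfun) < \<delta> \<Longrightarrow>
      \<exists>X. norm X \<le> 1 \<and> g = exp_blinfun (ad br (\<pi> X)) o\<^sub>L exp_blinfun (ad br (X - \<pi> X))"
    using lie_aut_local_factorization[OF \<pi>(1), of "\<lambda>X. X - \<pi> X" 1] zero_less_one by (smt (verit))
  have op: "openin (top_of_set (carrier (Aut0 br))) (carrier (Aut0 br) \<inter> R)"
    unfolding openin_contains_ball
  proof (intro conjI ballI)
    fix g assume "g \<in> carrier (Aut0 br) \<inter> R"
    then obtain k where g: "g \<in> carrier (Aut0 br)" and k: "k \<in> K_group br \<theta>" "k o\<^sub>L g \<in> stabilizer_n"
      by (auto simp: R_def)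
    have "k o\<^sub>L g \<in> lie_aut br"
      using g k(1) K_subset_lie_aut carrier_Aut0_subset by (intro lie_aut_compose) auto
    then obtain q where q: "q \<in> lie_aut br" "(k o\<^sub>L g) o\<^sub>L q = id_blinfun" "q o\<^sub>L (k o\<^sub>L g) = id_blinfun"
      by (rule lie_aut_inverse)
    \<comment> \<open>Bounds the effect of multiplying \<open>g' - g\<close> by \<open>k\<close> and
      \<open>q\<close>; the summand 1 makes it positive.\<close>
    define C where "C = norm k * norm q + 1"
    have C: "C > 0" by (auto simp: C_def intro: add_nonneg_pos)
    have "ball g (\<delta> / C) \<inter> carrier (Aut0 br) \<subseteq> carrier (Aut0 br) \<inter> R"
    proof
      fix g' assume g': "g' \<in> ball g (\<delta> / C) \<inter> carrier (Aut0 br)"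
      \<comment> \<open>As \<open>q\<close> inverts \<open>k o\<^sub>L g\<close>, the operator
        \<open>h\<close> is near the identity and
        \<open>k o\<^sub>L g' = h o\<^sub>L (k o\<^sub>L g)\<close>. The first factor of
        \<open>h\<close> can be absorbed into K and the second into
        \<open>stabilizer_n\<close>.\<close>
      define h where "h = k o\<^sub>L g' o\<^sub>L q"
      have "h \<in> lie_aut br"
        unfolding h_def using g' k(1) q(1) K_subset_lie_aut carrier_Aut0_subset by (intro lie_aut_compose) auto
      moreover have "norm (h - id_blinfun) < \<delta>"
      proof -
        have "h - id_blinfun = k o\<^sub>L (g' - g) o\<^sub>L q"
          unfolding h_def q(2)[symmetric] by (rule blinfun_eqI) (simp add: blinfun.bilinear_simps)
        then have "norm (h - id_blinfun) \<le> norm k * norm (g' - g) * norm q"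
          using norm_blinfun_compose[of "k o\<^sub>L (g' - g)" q]
            mult_right_mono[OF norm_blinfun_compose[of k "g' - g"] norm_ge_zero[of q]] by simp
        also have "\<dots> \<le> C * norm (g' - g)" by (simp add: C_def algebra_simps)
        also have "\<dots> < C * (\<delta> / C)"
          using g' C by (intro mult_strict_left_mono) (auto simp: dist_norm norm_minus_commute)
        finally show ?thesis using C by simp
      qed
      ultimately obtain X where X: "h = exp_blinfun (ad br (\<pi> X)) o\<^sub>L exp_blinfun (ad br (X - \<pi> X))"
        using \<delta>(2) by blast
      have kg': "k o\<^sub>L g' = h o\<^sub>L (k o\<^sub>L g)"
        using q(3)[THEN blinfun_compose_idD] by (auto intro!: blinfun_eqI simp: h_def)
      have "(exp_blinfun (ad br (- \<pi> X)) o\<^sub>L k) o\<^sub>L g' = exp_blinfun (ad br (X - \<pi> X)) o\<^sub>L (k o\<^sub>L g)"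
      proof (rule blinfun_eqI)
        fix Y
        have "blinfun_apply k (blinfun_apply g' Y) = blinfun_apply (exp_blinfun (ad br (\<pi> X)))
            (blinfun_apply (exp_blinfun (ad br (X - \<pi> X))) (blinfun_apply (k o\<^sub>L g) Y))"
          using arg_cong[OF kg', of "\<lambda>f. blinfun_apply f Y"] by (simp add: X)
        then show "blinfun_apply (exp_blinfun (ad br (- \<pi> X)) o\<^sub>L k o\<^sub>L g') Y
            = blinfun_apply (exp_blinfun (ad br (X - \<pi> X)) o\<^sub>L (k o\<^sub>L g)) Y"
          using exp_blinfun_minus(2)[of "ad br (\<pi> X)", THEN blinfun_compose_idD]
          by (simp add: ad_simps)
      qed
      also have "\<dots> \<in> stabilizer_n"
        using exp_ad_in_stabilizer_n[OF \<pi>(3)] k(2) by (rule stabilizer_n_compose)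
      finally have "(exp_blinfun (ad br (- \<pi> X)) o\<^sub>L k) o\<^sub>L g' \<in> stabilizer_n" .
      moreover have "exp_blinfun (ad br (- \<pi> X)) o\<^sub>L k \<in> K_group br \<theta>"
        using \<pi>(2) k(1) subspace_neg[OF subspace_cartan_k] by (intro K_compose exp_ad_in_K) auto
      ultimately show "g' \<in> carrier (Aut0 br) \<inter> R" using g' by (auto simp: R_def)
    qed
    then show "\<exists>e>0. ball g e \<inter> carrier (Aut0 br) \<subseteq> carrier (Aut0 br) \<inter> R"
      using \<delta>(1) C by (intro exI[of _ "\<delta> / C"]) auto
  qed auto
  have "connected (carrier (Aut0 br))" by (simp add: carrier_Aut0)
  then have "carrier (Aut0 br) \<inter> R = {} \<or> carrier (Aut0 br) \<inter> R = carrier (Aut0 br)"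
    using op cl unfolding connected_clopen by blast
  moreover have "id_blinfun \<in> carrier (Aut0 br) \<inter> R"
    using id_in_K K_subset_Aut0 by (auto simp: R_def stabilizer_n_def intro!: bexI[of _ id_blinfun])
  ultimately have "g \<in> R" using assms by blast
  then show ?thesis using that by (auto simp: R_def)
qed

theorem adjoint_orbit_eq:
  "adjoint_orbit br H = (\<Union>k\<in>K_group br \<theta>. (\<lambda>Z. blinfun_apply k (H + Z)) ` n_pos)"
proof (intro equalityI subsetI)
  fix x assume "x \<in> adjoint_orbit br H"
  then obtain g where g: "g \<in> carrier (Aut0 br)" "x = blinfun_apply g H"
    by (auto simp: adjoint_orbit_def)
  obtain k where k: "k \<in> K_group br \<theta>" "k o\<^sub>L g \<in> stabilizer_n" using Aut0_factorization[OF g(1)] .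
  then have z: "blinfun_apply k x - H \<in> n_pos"
    using subspace_0[OF subspace_eigensum, of "{0<..}"] g(2) unfolding stabilizer_n_def by force
  obtain l where l: "l \<in> K_group br \<theta>" "l o\<^sub>L k = id_blinfun" using K_inverse[OF k(1)] by blast
  have "x = blinfun_apply l (H + (blinfun_apply k x - H))"
    using l(2)[THEN blinfun_compose_idD] by simp
  then show "x \<in> (\<Union>k\<in>K_group br \<theta>. (\<lambda>Z. blinfun_apply k (H + Z)) ` n_pos)"
    using l(1) z by blast
next
  fix x assume "x \<in> (\<Union>k\<in>K_group br \<theta>. (\<lambda>Z. blinfun_apply k (H + Z)) ` n_pos)"
  then obtain k z where k: "k \<in> K_group br \<theta>" "z \<in> n_pos" "x = blinfun_apply k (H + z)" by blast
  obtain g where g: "g \<in> carrier (Aut0 br)" "blinfun_apply g (H + z) = H"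
    using n_pos_translate_to_H[OF k(2)] .
  let ?i = "inv\<^bsub>Aut0 br\<^esub> g"
  have "blinfun_apply ?i H = H + z"
    using Aut0_inv(2)[OF g(1), THEN blinfun_compose_idD] g(2) by metis
  then have "x = blinfun_apply (k o\<^sub>L ?i) H" using k(3) by simp
  moreover have "k o\<^sub>L ?i \<in> carrier (Aut0 br)"
    using monoid.m_closed[OF group.is_monoid[OF group_Aut0]] group.inv_closed[OF group_Aut0 g(1)]
      k(1) K_subset_Aut0 by (fastforce simp: mult_Aut0)
  ultimately show "x \<in> adjoint_orbit br H" unfolding adjoint_orbit_def by (rule image_eqI)
qed

end

text \<open>Root spaces lie in eigenspaces of \<open>ad H\<close>. Conversely \<open>a\<close> acts
  on each eigenspace by commuting symmetric operators, and a joint eigenvector in a positive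
  eigenspace belongs to a root that is positive at \<open>H\<close>.\<close>

lemma (in cartan_element) n_plus_eq:
  assumes a: "a \<subseteq> cartan_s \<theta>" "abelian_subspace br a" and H: "H \<in> a"
  shows "n_plus br a H = n_pos"
proof -
  have ab: "br A A' = 0" if "A \<in> a" "A' \<in> a" for A A'
    using that a(2) by (simp add: abelian_subspace_def)
  have br_commute: "br A (br A' x) = br A' (br A x)" if "A \<in> a" "A' \<in> a" for A A' x
    by (subst br_derivation) (simp add: ab that br.zero_left)
  have "root_space br a \<alpha> \<subseteq> eigenspace (\<alpha> H)" for \<alpha>
    using H by (auto simp: root_space_def eigenspace_def)
  then have "(\<Union>\<alpha>\<in>{\<alpha> \<in> roots br a. \<alpha> H > 0}. root_space br a \<alpha>) \<subseteq> n_pos"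
    using eigenspace_subset_eigensum by blast
  then have 1: "n_plus br a H \<subseteq> n_pos"
    unfolding n_plus_def by (intro span_minimal subspace_eigensum)
  have "eigenspace l \<subseteq> n_plus br a H" if l: "l > 0" for l
  proof -
    have "eigenspace l \<subseteq> span {x \<in> eigenspace l. \<forall>A\<in>br ` a. \<exists>m. A x = m *\<^sub>R x}"
    proof (rule commuting_symmetric_joint_eigenvectors)
      show "B_form br \<theta> (A x) y = B_form br \<theta> x (A y)" if "A \<in> br ` a" for A x y
        using that a(1) ad_symmetric by auto
      show "A (A' x) = A' (A x)" if "A \<in> br ` a" "A' \<in> br ` a" for A A' x
        using that br_commute by blast
      show "subspace (eigenspace l)"
        by (auto simp: eigenspace_def subspace_def br.zero_right br.add_right br.scaleR_right scaleR_add_right)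
      show "A x \<in> eigenspace l" if "A \<in> br ` a" "x \<in> eigenspace l" for A x
        using that br_commute[OF H] by (auto simp: eigenspace_def br.scaleR_right)
    qed (auto intro: bounded_linear.linear br.bounded_linear_right)
    also have "\<dots> \<subseteq> n_plus br a H"
      unfolding n_plus_def
    proof (intro span_minimal subspace_span subsetI)
      fix x assume "x \<in> {x \<in> eigenspace l. \<forall>A\<in>br ` a. \<exists>m. A x = m *\<^sub>R x}"
      then have x: "x \<in> eigenspace l" "\<And>A. A \<in> a \<Longrightarrow> \<exists>m. br A x = m *\<^sub>R x" by auto
      show "x \<in> span (\<Union>\<alpha>\<in>{\<alpha> \<in> roots br a. \<alpha> H > 0}. root_space br a \<alpha>)"
      proof (cases "x = 0")
        case False
        then have Bx: "B_form br \<theta> x x \<noteq> 0" by (simp add: form_eq_0_iff)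
        \<comment> \<open>This quotient is linear on the whole space and gives the joint eigenvalue
          on \<open>a\<close>, so the root comes with a representative of the required type.\<close>
        define \<alpha> where "\<alpha> A = B_form br \<theta> (br A x) x / B_form br \<theta> x x" for A
        have \<alpha>: "br A x = \<alpha> A *\<^sub>R x" if "A \<in> a" for A
          using x(2)[OF that] Bx by (auto simp: \<alpha>_def B.scaleR_left)
        have \<alpha>H: "\<alpha> H = l" using x(1) Bx by (simp add: \<alpha>_def eigenspace_def B.scaleR_left)
        have "linear \<alpha>"
          by (rule linearI) (simp_all add: \<alpha>_def br.add_left br.scaleR_left B.add_left B.scaleR_left add_divide_distrib)
        moreover have "x \<in> root_space br a \<alpha>" using \<alpha> by (simp add: root_space_def)
        ultimately have "\<alpha> \<in> roots br a"
          using H \<alpha>H l False by (auto simp: roots_def intro!: bexI[of _ H])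
        then show ?thesis using \<open>x \<in> root_space br a \<alpha>\<close> \<alpha>H l by (intro span_base) auto
      qed (simp add: span_zero)
    qed
    finally show ?thesis .
  qed
  then have "n_pos \<subseteq> n_plus br a H"
    unfolding eigensum_def n_plus_def by (intro span_minimal subspace_span) auto
  with 1 show ?thesis by blast
qed

section \<open>The deformed brackets\<close>

lemma connected_component_lie_aut_conjugate:
  assumes T: "T o\<^sub>L T' = id_blinfun" "T' o\<^sub>L T = id_blinfun"
    and br': "\<And>X Y. br' X Y = blinfun_apply T (br (blinfun_apply T' X) (blinfun_apply T' Y))"
    and g: "connected_component (lie_aut br) id_blinfun g"
  shows "connected_component (lie_aut br') id_blinfun (T o\<^sub>L g o\<^sub>L T')"
proof -
  let ?C = "connected_component_set (lie_aut br) id_blinfun"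
  note TT = T[THEN blinfun_compose_idD]
  have "connected ((\<lambda>g. T o\<^sub>L g o\<^sub>L T') ` ?C)"
    by (intro connected_continuous_image continuous_intros connected_connected_component)
  moreover have "T o\<^sub>L h o\<^sub>L T' \<in> lie_aut br'" if h: "h \<in> lie_aut br" for h
  proof -
    obtain q where q: "h o\<^sub>L q = id_blinfun" "q o\<^sub>L h = id_blinfun" using lie_aut_inverse[OF h] by blast
    show ?thesis
      by (rule lie_autI[of _ "T o\<^sub>L q o\<^sub>L T'"])
        (auto intro!: blinfun_eqI simp: TT q[THEN blinfun_compose_idD] br' lie_autD(2)[OF h])
  qed
  then have "(\<lambda>g. T o\<^sub>L g o\<^sub>L T') ` ?C \<subseteq> lie_aut br'"
    using connected_component_in by blast
  moreover have "id_blinfun \<in> (\<lambda>g. T o\<^sub>L g o\<^sub>L T') ` ?C"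
    using id_in_lie_aut by (intro image_eqI[of _ _ id_blinfun]) (auto intro: blinfun_eqI simp: TT)
  moreover have "T o\<^sub>L g o\<^sub>L T' \<in> (\<lambda>g. T o\<^sub>L g o\<^sub>L T') ` ?C"
    using g by blast
  ultimately show ?thesis unfolding connected_component_def by blast
qed

text \<open>\<open>T\<close> is an isomorphism from \<open>br\<close> to \<open>br'\<close>, so
  conjugation by it matches the identity components; the two inclusions exchange the roles of
  \<open>T\<close> and \<open>T'\<close>.\<close>

lemma adjoint_orbit_conjugate:
  assumes T: "T o\<^sub>L T' = id_blinfun" "T' o\<^sub>L T = id_blinfun"
    and br': "\<And>X Y. br' X Y = blinfun_apply T (br (blinfun_apply T' X) (blinfun_apply T' Y))"
  shows "adjoint_orbit br' (blinfun_apply T H) = blinfun_apply T ` adjoint_orbit br H"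
proof -
  note TT = T[THEN blinfun_compose_idD]
  have br: "br X Y = blinfun_apply T' (br' (blinfun_apply T X) (blinfun_apply T Y))" for X Y
    by (simp add: br' TT)
  show ?thesis
  proof (intro equalityI subsetI)
    fix x assume "x \<in> adjoint_orbit br' (blinfun_apply T H)"
    then obtain g where g: "connected_component (lie_aut br') id_blinfun g" "x = blinfun_apply g (blinfun_apply T H)"
      by (auto simp: adjoint_orbit_def carrier_Aut0)
    then have "connected_component (lie_aut br) id_blinfun (T' o\<^sub>L g o\<^sub>L T)"
      by (intro connected_component_lie_aut_conjugate[OF T(2,1), where br = br' and br' = br, OF br])
    moreover have "x = blinfun_apply T (blinfun_apply (T' o\<^sub>L g o\<^sub>L T) H)" using g(2) by (simp add: TT)
    ultimately show "x \<in> blinfun_apply T ` adjoint_orbit br H"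
      unfolding adjoint_orbit_def carrier_Aut0 by blast
  next
    fix x assume "x \<in> blinfun_apply T ` adjoint_orbit br H"
    then obtain g where g: "connected_component (lie_aut br) id_blinfun g" "x = blinfun_apply T (blinfun_apply g H)"
      by (auto simp: adjoint_orbit_def carrier_Aut0)
    then have "connected_component (lie_aut br') id_blinfun (T o\<^sub>L g o\<^sub>L T')"
      by (intro connected_component_lie_aut_conjugate[OF T, where br = br and br' = br', OF br'])
    moreover have "x = blinfun_apply (T o\<^sub>L g o\<^sub>L T') (blinfun_apply T H)" using g(2) by (simp add: TT)
    ultimately show "x \<in> adjoint_orbit br' (blinfun_apply T H)"
      unfolding adjoint_orbit_def carrier_Aut0 by blast
  qed
qed

lemma deform_T_apply:
  "blinfun_apply (deform_T \<theta> r) X = ((r + 1) / 2) *\<^sub>R X + ((r - 1) / 2) *\<^sub>R blinfun_apply \<theta> X"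
  by (simp add: deform_T_def blinfun.bilinear_simps algebra_simps add_divide_distrib diff_divide_distrib)

lemma psi_apply: "blinfun_apply (psi \<theta> r) X = X + ((r - 1) / (r + 1)) *\<^sub>R blinfun_apply \<theta> X"
  by (simp add: psi_def blinfun.bilinear_simps)

text \<open>\<open>deform_T \<theta> r\<close> grows without bound on
  \<open>cartan_k \<theta>\<close>; dividing by \<open>(r + 1) / 2\<close> gives a family with a
  limit. The scalar sits in the argument so that the subspace \<open>n_pos\<close> can absorb
  it.\<close>

lemma deform_T_eq_psi:
  assumes "r > 0"
  shows "blinfun_apply (deform_T \<theta> r) X = blinfun_apply (psi \<theta> r) (((r + 1) / 2) *\<^sub>R X)"
  using assms by (simp add: deform_T_apply psi_apply blinfun.scaleR_right field_simps)

lemma psi_tendsto: "(psi \<theta> \<longlongrightarrow> psi_lim \<theta>) at_top"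
proof -
  have "((\<lambda>r::real. 2 / (r + 1)) \<longlongrightarrow> 0) at_top"
    by (intro tendsto_divide_0[OF tendsto_const] filterlim_at_top_imp_at_infinity
        filterlim_at_top_mono[OF filterlim_ident] always_eventually) auto
  then have "((\<lambda>r::real. 1 - 2 / (r + 1)) \<longlongrightarrow> 1 - 0) at_top" by (intro tendsto_intros)
  moreover have "\<forall>\<^sub>F r::real in at_top. 1 - 2 / (r + 1) = (r - 1) / (r + 1)"
    using eventually_gt_at_top[of 0] by eventually_elim (simp add: field_simps)
  ultimately have "((\<lambda>r::real. (r - 1) / (r + 1)) \<longlongrightarrow> 1) at_top"
    by (simp add: filterlim_cong)
  then have "((\<lambda>r. id_blinfun + ((r - 1) / (r + 1)) *\<^sub>R \<theta>) \<longlongrightarrow> id_blinfun + 1 *\<^sub>R \<theta>) at_top"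
    by (intro tendsto_intros)
  then show ?thesis by (simp add: psi_def[abs_def] psi_lim_def)
qed

lemma deform_bracket_1: "deform_bracket br \<theta> 1 = br"
proof -
  have "blinfun_apply (deform_T \<theta> 1) = id" by (auto simp: deform_T_apply)
  then show ?thesis by (simp add: deform_bracket_def[abs_def])
qed

lemma (in cartan_decomposition) deform_T_inverse:
  assumes "r > 0"
  shows "deform_T \<theta> r o\<^sub>L deform_T \<theta> (1 / r) = id_blinfun"
proof (rule blinfun_eqI)
  fix X
  have "blinfun_apply (deform_T \<theta> r o\<^sub>L deform_T \<theta> (1 / r)) X
    = ((r + 1) / 2 * ((1 / r + 1) / 2) + (r - 1) / 2 * ((1 / r - 1) / 2)) *\<^sub>R X
     + ((r + 1) / 2 * ((1 / r - 1) / 2) + (r - 1) / 2 * ((1 / r + 1) / 2)) *\<^sub>R blinfun_apply \<theta> X"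
    by (simp add: deform_T_apply blinfun.bilinear_simps scaleR_add_right scaleR_add_left ac_simps)
  also have "(r + 1) / 2 * ((1 / r + 1) / 2) + (r - 1) / 2 * ((1 / r - 1) / 2) = 1"
    using assms by (simp add: field_simps)
  also have "(r + 1) / 2 * ((1 / r - 1) / 2) + (r - 1) / 2 * ((1 / r + 1) / 2) = 0"
    using assms by (simp add: field_simps)
  finally show "blinfun_apply (deform_T \<theta> r o\<^sub>L deform_T \<theta> (1 / r)) X = blinfun_apply id_blinfun X" by simp
qed

text \<open>\<open>T\<close> fixes \<open>H\<close> and every \<open>k H\<close>, which lie in
  \<open>cartan_s \<theta>\<close>, so the deformed orbit of \<open>H\<close> is the
  \<open>T\<close>-image of the original one and only the part in \<open>k n_pos\<close> is
  changed.\<close>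

lemma (in cartan_element) adjoint_orbit_deform_bracket:
  assumes r: "r > 0"
  shows "adjoint_orbit (deform_bracket br \<theta> r) H =
    (\<Union>k\<in>K_group br \<theta>. (\<lambda>Z. blinfun_apply k H + blinfun_apply (psi \<theta> r) (blinfun_apply k Z)) ` n_pos)"
proof -
  define T where "T = deform_T \<theta> r"
  define T' where "T' = deform_T \<theta> (1 / r)"
  have T: "T o\<^sub>L T' = id_blinfun" "T' o\<^sub>L T = id_blinfun"
    using deform_T_inverse[of r] deform_T_inverse[of "1 / r"] r by (simp_all add: T_def T'_def)
  have "inv_into UNIV (blinfun_apply T) X = blinfun_apply T' X" for X
    using T[THEN blinfun_compose_idD] by (metis inv_f_eq injI)
  then have "deform_bracket br \<theta> r X Y = blinfun_apply T (br (blinfun_apply T' X) (blinfun_apply T' Y))" for X Y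
    by (simp add: deform_bracket_def T_def)
  then have orbit: "adjoint_orbit (deform_bracket br \<theta> r) (blinfun_apply T H) = blinfun_apply T ` adjoint_orbit br H"
    by (rule adjoint_orbit_conjugate[OF T])
  have TH: "blinfun_apply T H = H" using deform_T_s[OF H_in_s] by (simp add: T_def)
  have step: "blinfun_apply T (blinfun_apply k (H + Z))
      = blinfun_apply k H + blinfun_apply (psi \<theta> r) (blinfun_apply k (((r + 1) / 2) *\<^sub>R Z))"
    if "k \<in> K_group br \<theta>" for k Z
  proof -
    have "blinfun_apply k H \<in> cartan_s \<theta>"
      using blinfun_compose_commuteD[OF K_theta[OF that]] by (simp add: cartan_s_def theta_H blinfun.minus_right)
    then have "blinfun_apply T (blinfun_apply k H) = blinfun_apply k H" by (simp add: T_def deform_T_s)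
    then show ?thesis by (simp add: blinfun.add_right deform_T_eq_psi[OF r, folded T_def] blinfun.scaleR_right T_def)
  qed
  have scale: "(\<lambda>Z. ((r + 1) / 2) *\<^sub>R Z) ` n_pos = n_pos"
  proof (intro equalityI subsetI)
    fix Z assume "Z \<in> n_pos"
    then have "(2 / (r + 1)) *\<^sub>R Z \<in> n_pos" by (rule subspace_scale[OF subspace_eigensum])
    moreover have "(r + 1) / 2 * (2 / (r + 1)) = 1" using r by simp
    then have "Z = ((r + 1) / 2) *\<^sub>R ((2 / (r + 1)) *\<^sub>R Z)" by (simp only: scaleR_scaleR scaleR_one)
    ultimately show "Z \<in> (\<lambda>Z. ((r + 1) / 2) *\<^sub>R Z) ` n_pos" by blast
  qed (use subspace_scale[OF subspace_eigensum] in blast)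
  have "adjoint_orbit (deform_bracket br \<theta> r) H
      = (\<Union>k\<in>K_group br \<theta>. (\<lambda>Z. blinfun_apply T (blinfun_apply k (H + Z))) ` n_pos)"
    using orbit by (simp add: TH adjoint_orbit_eq image_UN image_image)
  also have "\<dots> = (\<Union>k\<in>K_group br \<theta>. (\<lambda>Z. blinfun_apply k H + blinfun_apply (psi \<theta> r) (blinfun_apply k Z))
      ` (\<lambda>Z. ((r + 1) / 2) *\<^sub>R Z) ` n_pos)"
    by (simp add: step image_image)
  finally show ?thesis by (simp only: scale)
qed

section \<open>The coadjoint orbit of the semi-direct product\<close>

context cartan_decomposition
begin

lemma K_preserves:
  assumes "k \<in> K_group br \<theta>"
  shows "X \<in> cartan_k \<theta> \<Longrightarrow> blinfun_apply k X \<in> cartan_k \<theta>"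
    and "X \<in> cartan_s \<theta> \<Longrightarrow> blinfun_apply k X \<in> cartan_s \<theta>"
  using blinfun_compose_commuteD[OF K_theta[OF assms]]
  by (auto simp: cartan_k_def cartan_s_def blinfun.minus_right)

lemma br_k_s: "X \<in> cartan_k \<theta> \<Longrightarrow> Y \<in> cartan_s \<theta> \<Longrightarrow> br X Y \<in> cartan_s \<theta>"
  and br_s_s: "X \<in> cartan_s \<theta> \<Longrightarrow> Y \<in> cartan_s \<theta> \<Longrightarrow> br X Y \<in> cartan_k \<theta>"
  by (simp_all add: cartan_k_def cartan_s_def theta_br br.minus_left br.minus_right)

lemma B_form_k_s:
  assumes "X \<in> cartan_k \<theta>" "Y \<in> cartan_s \<theta>"
  shows "B_form br \<theta> X Y = 0" "B_form br \<theta> Y X = 0"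
proof -
  have "B_form br \<theta> (blinfun_apply \<theta> X) (blinfun_apply \<theta> Y) = B_form br \<theta> X Y"
    by (simp add: B_form_def killing_theta)
  then show "B_form br \<theta> X Y = 0" using assms by (simp add: cartan_k_def cartan_s_def B.minus_right)
  then show "B_form br \<theta> Y X = 0" by (simp add: form_commute[of Y])
qed

lemma B_form_eqI:
  assumes "\<And>X Y. X \<in> cartan_k \<theta> \<Longrightarrow> Y \<in> cartan_s \<theta> \<Longrightarrow> B_form br \<theta> Z (X + Y) = B_form br \<theta> Z' (X + Y)"
  shows "Z = Z'"
proof (rule form_eqI)
  fix X
  have "B_form br \<theta> Z ((X + blinfun_apply \<theta> X) + (X - blinfun_apply \<theta> X))
      = B_form br \<theta> Z' ((X + blinfun_apply \<theta> X) + (X - blinfun_apply \<theta> X))"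
    by (intro assms cartan_k_part cartan_s_part)
  then show "B_form br \<theta> Z X = B_form br \<theta> Z' X" by (simp add: B.add_right)
qed

text \<open>\<open>inv\<close> is a definite description, so the group axioms come before the check
  of the formula by a product.\<close>

lemma K_ad_inverse:
  assumes k: "k \<in> K_group br \<theta>" and v: "v \<in> cartan_s \<theta>"
    and l: "l \<in> K_group br \<theta>" "k o\<^sub>L l = id_blinfun" "l o\<^sub>L k = id_blinfun"
  shows "inv\<^bsub>K_ad br \<theta>\<^esub> (k, v) = (l, - blinfun_apply l v)"
proof -
  have "group (K_ad br \<theta>)"
  proof (rule groupI)
    fix p assume "p \<in> carrier (K_ad br \<theta>)"
    then obtain k v where p: "p = (k, v)" "k \<in> K_group br \<theta>" "v \<in> cartan_s \<theta>" by (auto simp: K_ad_def)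
    obtain l where l: "l \<in> K_group br \<theta>" "l o\<^sub>L k = id_blinfun" using K_inverse[OF p(2)] by blast
    then show "\<exists>q\<in>carrier (K_ad br \<theta>). q \<otimes>\<^bsub>K_ad br \<theta>\<^esub> p = \<one>\<^bsub>K_ad br \<theta>\<^esub>"
      using p K_preserves(2) subspace_neg[OF subspace_cartan_s]
      by (intro bexI[of _ "(l, - blinfun_apply l v)"]) (auto simp: K_ad_def)
  qed (auto simp: K_ad_def K_compose id_in_K K_preserves blinfun.add_right add.assoc subspace_0 subspace_add
      subspace_cartan_s intro: blinfun_eqI)
  then show ?thesis
    using k l v K_preserves(2)[OF l(1) v] subspace_neg[OF subspace_cartan_s]
    by (intro group.inv_equality) (auto simp: K_ad_def)
qed

lemma ad_eq_iff: "ad br X = ad br Y \<longleftrightarrow> X = Y"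
  using killing_eqI[of X Y] by (auto simp: killing_def)

text \<open>Conjugating the curve by \<open>(k, v)\<close> puts
  \<open>- (k exp (t ad X) l) v\<close> into the second component, with \<open>l\<close> inverse to
  \<open>k\<close>; its derivative at 0 is the bracket term.\<close>

lemma K_ad_Ad_eq:
  assumes k: "k \<in> K_group br \<theta>" and v: "v \<in> cartan_s \<theta>" and X: "X \<in> cartan_k \<theta>" and Y: "Y \<in> cartan_s \<theta>"
  shows "K_ad_Ad br \<theta> (k, v) (X, Y) = (blinfun_apply k X, blinfun_apply k Y - br (blinfun_apply k X) v)"
proof -
  obtain l where l: "l \<in> K_group br \<theta>" "k o\<^sub>L l = id_blinfun" "l o\<^sub>L k = id_blinfun"
    using K_inverse[OF k] .
  let ?e = "\<lambda>t. exp_blinfun (t *\<^sub>R ad br X)"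
  let ?c = "\<lambda>t. (k, v) \<otimes>\<^bsub>K_ad br \<theta>\<^esub> (?e t, t *\<^sub>R Y) \<otimes>\<^bsub>K_ad br \<theta>\<^esub> inv\<^bsub>K_ad br \<theta>\<^esub> (k, v)"
  have c: "?c = (\<lambda>t. (k o\<^sub>L ?e t o\<^sub>L l, v + t *\<^sub>R blinfun_apply k Y - blinfun_apply (k o\<^sub>L ?e t o\<^sub>L l) v))"
    unfolding K_ad_inverse[OF k v l]
    by (rule ext) (simp add: K_ad_def blinfun.scaleR_right blinfun.minus_right)
  have e: "(?e has_vector_derivative ad br X) (at 0)"
    using exp_blinfun_has_vector_derivative(1)[of "ad br X" 0]
    by (simp add: exp_blinfun_0 id_blinfun_compose)
  have kl: "k o\<^sub>L ad br X o\<^sub>L l = ad br (blinfun_apply k X)"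
    using lie_autD(2)[OF subsetD[OF K_subset_lie_aut k]] l(2)[THEN blinfun_compose_idD]
    by (auto intro!: blinfun_eqI)
  have "((\<lambda>t. k o\<^sub>L ?e t o\<^sub>L l) has_vector_derivative k o\<^sub>L ad br X o\<^sub>L l) (at 0)"
    using bounded_linear.has_vector_derivative[OF bounded_linear_compose[OF
        bounded_bilinear.bounded_linear_left[OF bounded_bilinear_blinfun_compose]
        bounded_bilinear.bounded_linear_right[OF bounded_bilinear_blinfun_compose]] e] .
  then have 1: "((\<lambda>t. k o\<^sub>L ?e t o\<^sub>L l) has_vector_derivative ad br (blinfun_apply k X)) (at 0)"
    by (simp only: kl)
  have 2: "((\<lambda>t. v + t *\<^sub>R blinfun_apply k Y - blinfun_apply (k o\<^sub>L ?e t o\<^sub>L l) v) has_vector_derivative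
      blinfun_apply k Y - br (blinfun_apply k X) v) (at 0)"
    using bounded_linear.has_vector_derivative[OF blinfun.bounded_linear_left[of v] 1]
    by (auto intro!: derivative_eq_intros)
  have der: "(?c has_vector_derivative (ad br (blinfun_apply k X), blinfun_apply k Y - br (blinfun_apply k X) v)) (at 0)"
    unfolding c by (rule has_vector_derivative_Pair[OF 1 2])
  show ?thesis
    unfolding K_ad_Ad_def fst_conv snd_conv
  proof (rule the_equality)
    show "(blinfun_apply k X, blinfun_apply k Y - br (blinfun_apply k X) v) \<in> cartan_k \<theta> \<times> cartan_s \<theta> \<and>
      (?c has_vector_derivative (ad br (fst (blinfun_apply k X, blinfun_apply k Y - br (blinfun_apply k X) v)),
        snd (blinfun_apply k X, blinfun_apply k Y - br (blinfun_apply k X) v))) (at 0)"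
      using der K_preserves[OF k] X Y v br_k_s by (auto intro: subspace_diff[OF subspace_cartan_s])
  next
    \<comment> \<open>Injectivity of \<open>ad\<close> makes the velocity determine the Lie algebra
      element, as the definite description requires.\<close>
    fix \<eta> assume "\<eta> \<in> cartan_k \<theta> \<times> cartan_s \<theta> \<and> (?c has_vector_derivative (ad br (fst \<eta>), snd \<eta>)) (at 0)"
    then have "(ad br (fst \<eta>), snd \<eta>) = (ad br (blinfun_apply k X), blinfun_apply k Y - br (blinfun_apply k X) v)"
      using vector_derivative_unique_at[OF _ der] by blast
    then show "\<eta> = (blinfun_apply k X, blinfun_apply k Y - br (blinfun_apply k X) v)"
      by (simp add: ad_eq_iff prod_eq_iff)
  qed
qed

end

context cartan_element
begin

text \<open>\<open>ad w\<close> is symmetric and K acts by isometries of \<open>B_form\<close>, so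
  both move to the other argument; the mixed terms vanish as \<open>cartan_k \<theta>\<close> and
  \<open>cartan_s \<theta>\<close> are orthogonal.\<close>

lemma coadjoint_functional:
  assumes k: "k \<in> K_group br \<theta>" and l: "l \<in> K_group br \<theta>" "k o\<^sub>L l = id_blinfun"
    and w: "w \<in> cartan_s \<theta>" and X: "X \<in> cartan_k \<theta>" and Y: "Y \<in> cartan_s \<theta>"
  shows "B_form br \<theta> H (blinfun_apply l X + (blinfun_apply l Y - br (blinfun_apply l X) w))
    = B_form br \<theta> (blinfun_apply k (H + br w H)) (X + Y)"
proof -
  have k_aut: "B_form br \<theta> (blinfun_apply k U) V = B_form br \<theta> U (blinfun_apply l V)" for U V
    using B_form_aut_theta[of k U "blinfun_apply l V"] k K_subset_aut_theta l(2)[THEN blinfun_compose_idD] by auto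
  have wH: "br w H \<in> cartan_k \<theta>" using w H_in_s by (rule br_s_s)
  have "- B_form br \<theta> H (br (blinfun_apply l X) w) = B_form br \<theta> H (br w (blinfun_apply l X))"
    by (subst br_anticommute) (simp add: B.minus_right)
  also have "\<dots> = B_form br \<theta> (br w H) (blinfun_apply l X)"
    using ad_symmetric[OF w] by simp
  finally show ?thesis
    using B_form_k_s[OF K_preserves(1)[OF l(1) X] H_in_s] B_form_k_s[OF wH K_preserves(2)[OF l(1) Y]]
    by (simp add: k_aut B.add_left B.add_right B.diff_right blinfun.add_right)
qed

lemma K_ad_coadjoint_orbit_eq:
  "K_ad_coadjoint_orbit br \<theta> H = (\<Union>k\<in>K_group br \<theta>. (\<lambda>w. blinfun_apply k (H + br w H)) ` cartan_s \<theta>)"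
proof (intro equalityI subsetI)
  fix Z assume "Z \<in> K_ad_coadjoint_orbit br \<theta> H"
  then obtain k v where k: "k \<in> K_group br \<theta>" and v: "v \<in> cartan_s \<theta>"
    and Z: "\<And>X Y. X \<in> cartan_k \<theta> \<Longrightarrow> Y \<in> cartan_s \<theta> \<Longrightarrow> B_form br \<theta> Z (X + Y) =
       (case K_ad_Ad br \<theta> (inv\<^bsub>K_ad br \<theta>\<^esub> (k, v)) (X, Y) of (X', Y') \<Rightarrow> B_form br \<theta> H (X' + Y'))"
    unfolding K_ad_coadjoint_orbit_def by (auto simp: K_ad_def)
  obtain l where l: "l \<in> K_group br \<theta>" "k o\<^sub>L l = id_blinfun" "l o\<^sub>L k = id_blinfun"
    using K_inverse[OF k] .
  define w where "w = - blinfun_apply l v"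
  have w: "w \<in> cartan_s \<theta>"
    unfolding w_def using K_preserves(2)[OF l(1) v] subspace_neg[OF subspace_cartan_s] by blast
  have "B_form br \<theta> Z (X + Y) = B_form br \<theta> (blinfun_apply k (H + br w H)) (X + Y)"
    if "X \<in> cartan_k \<theta>" "Y \<in> cartan_s \<theta>" for X Y
    using Z[OF that] coadjoint_functional[OF k l(1,2) w that]
    by (simp add: K_ad_inverse[OF k v l] K_ad_Ad_eq[OF l(1) w that] flip: w_def)
  then have "Z = blinfun_apply k (H + br w H)" by (rule B_form_eqI)
  then show "Z \<in> (\<Union>k\<in>K_group br \<theta>. (\<lambda>w. blinfun_apply k (H + br w H)) ` cartan_s \<theta>)"
    using k w by blast
next
  fix Z assume "Z \<in> (\<Union>k\<in>K_group br \<theta>. (\<lambda>w. blinfun_apply k (H + br w H)) ` cartan_s \<theta>)"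
  then obtain k w where k: "k \<in> K_group br \<theta>" and w: "w \<in> cartan_s \<theta>" and Z: "Z = blinfun_apply k (H + br w H)"
    by blast
  obtain l where l: "l \<in> K_group br \<theta>" "k o\<^sub>L l = id_blinfun" "l o\<^sub>L k = id_blinfun"
    using K_inverse[OF k] .
  \<comment> \<open>Chosen so that the inverse of \<open>(k, v)\<close> has second component
    \<open>w\<close>; thus \<open>w\<close> runs through all of
    \<open>cartan_s \<theta>\<close>.\<close>
  define v where "v = - blinfun_apply k w"
  have v: "v \<in> cartan_s \<theta>"
    unfolding v_def using K_preserves(2)[OF k w] subspace_neg[OF subspace_cartan_s] by blast
  have "- blinfun_apply l v = w"
    using l(3)[THEN blinfun_compose_idD] by (simp add: v_def blinfun.minus_right)
  then have inv: "inv\<^bsub>K_ad br \<theta>\<^esub> (k, v) = (l, w)" using K_ad_inverse[OF k v l] by simp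
  have "(k, v) \<in> carrier (K_ad br \<theta>)" using k v by (simp add: K_ad_def)
  moreover have "\<forall>X\<in>cartan_k \<theta>. \<forall>Y\<in>cartan_s \<theta>. B_form br \<theta> Z (X + Y) =
       (case K_ad_Ad br \<theta> (inv\<^bsub>K_ad br \<theta>\<^esub> (k, v)) (X, Y) of (X', Y') \<Rightarrow> B_form br \<theta> H (X' + Y'))"
    using coadjoint_functional[OF k l(1,2) w] K_ad_Ad_eq[OF l(1) w] by (simp add: inv Z)
  ultimately show "Z \<in> K_ad_coadjoint_orbit br \<theta> H"
    unfolding K_ad_coadjoint_orbit_def by blast
qed

text \<open>If \<open>Z = [H, X]\<close>, then \<open>Z + \<theta> Z = [H, X - \<theta> X]\<close>
  because \<theta> negates \<open>H\<close>. Conversely the sign of each eigenvalue decides whether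
  \<open>X\<close> or \<open>\<theta> X\<close> supplies the preimage in
  \<open>n_pos\<close>.\<close>

lemma psi_lim_n_pos: "blinfun_apply (psi_lim \<theta>) ` n_pos = (\<lambda>w. br w H) ` cartan_s \<theta>"
proof (intro equalityI subsetI)
  fix x assume "x \<in> blinfun_apply (psi_lim \<theta>) ` n_pos"
  then obtain Z where Z: "Z \<in> n_pos" "x = Z + blinfun_apply \<theta> Z" by (auto simp: psi_lim_def blinfun.add_left)
  obtain X where X: "br H X = Z" using ad_H_preimage[OF Z(1)] by auto
  have "x = br H (X - blinfun_apply \<theta> X)"
    using theta_br[of H X] by (simp add: Z(2) X[symmetric] theta_H br.minus_left br.diff_right)
  then have "x = br (- (X - blinfun_apply \<theta> X)) H"
    using br_anticommute[of H "X - blinfun_apply \<theta> X"] by (simp only: br.minus_left)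
  moreover have "- (X - blinfun_apply \<theta> X) \<in> cartan_s \<theta>"
    by (intro subspace_neg subspace_cartan_s cartan_s_part)
  ultimately show "x \<in> (\<lambda>w. br w H) ` cartan_s \<theta>" by blast
next
  fix x assume "x \<in> (\<lambda>w. br w H) ` cartan_s \<theta>"
  then obtain w where w: "w \<in> cartan_s \<theta>" "x = br w H" by blast
  \<comment> \<open>Eigencomponents of \<open>w\<close> need not stay in
    \<open>cartan_s \<theta>\<close>. The induction therefore concerns \<open>X - \<theta> X\<close>
    for arbitrary \<open>X\<close>, which equals \<open>w\<close> at
    \<open>X = w / 2\<close>.\<close>
  have "(1/2) *\<^sub>R w \<in> eigensum UNIV" by (simp add: eigensum_UNIV)
  then have "(1/2) *\<^sub>R w \<in> {X. br (X - blinfun_apply \<theta> X) H \<in> blinfun_apply (psi_lim \<theta>) ` n_pos}"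
  proof (induction rule: eigensum_induct)
    case (eigenvector l X)
    have eq: "br (X - blinfun_apply \<theta> X) H = - l *\<^sub>R X - l *\<^sub>R blinfun_apply \<theta> X"
      using eigenvector theta_eigenspace[OF eigenvector(2)] br_anticommute[of _ H]
      by (simp add: eigenspace_def br.diff_left br.diff_right)
    consider "l > 0" | "l < 0" | "l = 0" by linarith
    then show ?case
    proof cases
      case 1
      then have "X \<in> n_pos"
        using eigenvector(2) eigenspace_subset_eigensum by auto
      then have "- l *\<^sub>R X \<in> n_pos" by (rule subspace_scale[OF subspace_eigensum])
      moreover have "br (X - blinfun_apply \<theta> X) H = blinfun_apply (psi_lim \<theta>) (- l *\<^sub>R X)"
        unfolding eq by (simp add: psi_lim_def blinfun.bilinear_simps scaleR_add_right)
      ultimately show ?thesis by blast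
    next
      case 2
      then have "- l *\<^sub>R blinfun_apply \<theta> X \<in> n_pos"
        using theta_eigenspace[OF eigenvector(2)] eigenspace_subset_eigensum[of "- l" "{0<..}"]
          subspace_scale[OF subspace_eigensum] by (metis greaterThan_iff neg_0_less_iff_less)
      moreover have "br (X - blinfun_apply \<theta> X) H = blinfun_apply (psi_lim \<theta>) (- l *\<^sub>R blinfun_apply \<theta> X)"
        unfolding eq by (simp add: psi_lim_def blinfun.bilinear_simps algebra_simps)
      ultimately show ?thesis by blast
    next
      case 3
      then have "br (X - blinfun_apply \<theta> X) H = blinfun_apply (psi_lim \<theta>) 0" unfolding eq by simp
      then show ?thesis using subspace_0[OF subspace_eigensum] by blast
    qed
  next
    case subspace
    have "linear (\<lambda>X. br (X - blinfun_apply \<theta> X) H)"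
      by (rule linearI) (simp_all add: blinfun.bilinear_simps br.diff_left br.add_left br.scaleR_left scaleR_diff_right)
    then show ?case
      by (intro linear_subspace_linear_preimage linear_subspace_image subspace_eigensum)
        (auto intro: bounded_linear.linear blinfun.bounded_linear_right)
  qed
  moreover have "(1/2) *\<^sub>R w - blinfun_apply \<theta> ((1/2) *\<^sub>R w) = w"
    using w(1) by (simp add: cartan_s_def blinfun.scaleR_right flip: scaleR_add_left)
  ultimately show "x \<in> blinfun_apply (psi_lim \<theta>) ` n_pos" using w(2) by simp
qed

end

theorem corollary12:
  fixes br :: "'a::euclidean_space \<Rightarrow> 'a \<Rightarrow> 'a"
    and \<theta> :: "'a \<Rightarrow>\<^sub>L 'a"
    and a C :: "'a set"
    and H :: 'a
  assumes "semisimple_lie br"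
    and "\<not> compact_type br"
    and "cartan_involution br \<theta>"
    and "maximal_abelian_in br (cartan_s \<theta>) a"
    and "C \<in> weyl_chambers br a"
    and "H \<in> closure C"
  shows "(\<forall>r>0. adjoint_orbit (deform_bracket br \<theta> r) H =
            (\<Union>k\<in>K_group br \<theta>.
               (\<lambda>Z. blinfun_apply k H + blinfun_apply (psi \<theta> r) (blinfun_apply k Z)) ` n_plus br a H))
       \<and> adjoint_orbit (deform_bracket br \<theta> 1) H = adjoint_orbit br H
       \<and> (psi \<theta> \<longlongrightarrow> psi_lim \<theta>) at_top
       \<and> (\<Union>k\<in>K_group br \<theta>.
            (\<lambda>Z. blinfun_apply k (H + blinfun_apply (psi_lim \<theta>) Z)) ` n_plus br a H)
          = K_ad_coadjoint_orbit br \<theta> H"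
proof -
  have a: "a \<subseteq> cartan_s \<theta>" "abelian_subspace br a"
    using assms(4) by (auto simp: maximal_abelian_in_def)
  have "C \<subseteq> a"
    using assms(5) in_components_subset unfolding weyl_chambers_def by blast
  then have "closure C \<subseteq> a"
    using a(2) by (intro closure_minimal) (auto simp: abelian_subspace_def closed_subspace)
  with assms(6) have H: "H \<in> a" by blast
  interpret cartan_element br \<theta> H
    using assms(1,3) a(1) H by unfold_locales (auto simp: semisimple_lie_def)
  have n: "n_plus br a H = n_pos" by (rule n_plus_eq[OF a H])
  have "(\<Union>k\<in>K_group br \<theta>. (\<lambda>Z. blinfun_apply k (H + blinfun_apply (psi_lim \<theta>) Z)) ` n_pos)
      = (\<Union>k\<in>K_group br \<theta>. (\<lambda>Y. blinfun_apply k (H + Y)) ` blinfun_apply (psi_lim \<theta>) ` n_pos)"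
    by (simp add: image_image)
  also have "\<dots> = K_ad_coadjoint_orbit br \<theta> H"
    unfolding psi_lim_n_pos K_ad_coadjoint_orbit_eq by (simp add: image_image)
  finally show ?thesis
    unfolding n using adjoint_orbit_deform_bracket psi_tendsto by (simp add: deform_bracket_1)
qed

end
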